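(* Every squarefree positive integer having at least $45$ prime factors is matchable.
   Context: For a positive integer $n$, let $D(n)$ be its set of positive divisors and $\tau(n)=|D(n)|$. A coprime matching between two finite sets of integers of the same cardinality is a bijection $\psi$ between them such that $\gcd(x,\psi(x))=1$ for every $x$ in the domain. A positive integer $n$ is called matchable if there is a coprime matching between $\{1,2,\dots,\tau(n)\}$ and $D(n)$. *)

theory Defs
  imports "HOL-Computational_Algebra.Computational_Algebra"
begin

definition divisors :: "nat \<Rightarrow> nat set" where
  "divisors n = {d. d dvd n}"

definition divisor_count :: "nat \<Rightarrow> nat" where
  "divisor_count n = card (divisors n)"

(* The cardinalities of A and B agree because of bij_betw. *)
definition coprime_matching :: "nat set \<Rightarrow> nat set \<Rightarrow> (nat \<Rightarrow> nat) \<Rightarrow> bool" where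
  "coprime_matching A B \<psi> \<longleftrightarrow>
     finite A \<and> finite B \<and> bij_betw \<psi> A B \<and> (\<forall>x\<in>A. gcd x (\<psi> x) = 1)"

(* Meant for n > 0: every natural number divides 0, so divisors 0 is infinite. *)
definition matchable :: "nat \<Rightarrow> bool" where
  "matchable n \<longleftrightarrow> (\<exists>\<psi>. coprime_matching {1..divisor_count n} (divisors n) \<psi>)"

end

theory Submission
  imports Defs "HOL-Analysis.Harmonic_Numbers"
begin

text \<open>
  A divisor of \<open>n\<close> is prime to \<open>x\<close> iff the complementary set \<open>C\<close> of prime factors contains all
  prime factors of \<open>n\<close> dividing \<open>x\<close>; let \<open>S x\<close> be the set of the latter. So we want a bijection
  \<open>x \<mapsto> C\<close> onto the sets of prime factors with \<open>S x \<subseteq> C\<close>. If \<open>2\<close> divides \<open>n\<close>, the even \<open>x\<close> go to the sets containing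
  \<open>2\<close> and the odd \<open>x\<close> to the others; in all cases it remains to treat \<open>m \<ge> 44\<close> odd primes and the
  progression \<open>1 + c * i\<close>, \<open>i < N = 2 ^ m\<close>, \<open>c \<in> {1, 2}\<close>.

  By Hall's theorem one needs \<open>card {x. S x \<in> U} \<le> card U\<close> for every up-set \<open>U\<close>. Split the primes into
  the small ones \<open>P1\<close> and the large ones \<open>P2\<close>, with \<open>\<sigma> = (\<Sum>p\<in>P2. 1 / p) \<le> 20 / 27\<close>. Distribute \<open>x\<close> over
  the subsets \<open>C1\<close> of \<open>P1\<close> by adding each small prime not dividing \<open>x\<close> with such a probability that
  it lies in \<open>C1\<close> for exactly half of the residues; up to an error from incomplete periods, every \<open>C1\<close>
  then receives equal weight, also from the multiples of any product of large primes. Fix \<open>C1\<close> and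
  let \<open>r\<close> be the smallest size of a member of the section of \<open>U\<close> over \<open>C1\<close>. The section has density
  at least \<open>1 / 2 ^ r\<close>, while its weight has density at most \<open>\<sigma> ^ r / fact r\<close>. This suffices for
  \<open>r \<ge> 3\<close>; for \<open>r \<le> 2\<close> one distinguishes whether the section has one or several members of size \<open>r\<close>.
  The case \<open>r = 0\<close> needs no loss at all, and there the error is absorbed by the \<open>x\<close> prime to \<open>n\<close>.
\<close>

section \<open>Hall's theorem and the coupling for the small primes\<close>

text \<open>Halmos-Vaughan induction on \<open>card A\<close>. If some proper nonempty
  \<open>J\<close> is tight, it is matched first and the rest avoids its neighbourhood; otherwise
  any single edge can be fixed, since every smaller nonempty set has a spare neighbour.\<close>

lemma hall_marriage:
  fixes F :: "'a \<Rightarrow> 'b set"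
  assumes "finite A" "\<And>a. a \<in> A \<Longrightarrow> finite (F a)"
    and "\<And>J. J \<subseteq> A \<Longrightarrow> card J \<le> card (\<Union>(F ` J))"
  shows "\<exists>h. inj_on h A \<and> (\<forall>a\<in>A. h a \<in> F a)"
  using assms
proof (induction "card A" arbitrary: A F rule: less_induct)
  case less
  note fin = less.prems(1,2) and hall = less.prems(3)
  have finU: "finite (\<Union>(F ` J))" if "J \<subseteq> A" for J
    using that fin finite_subset by blast
  show ?case
  proof (cases "\<exists>J. J \<subset> A \<and> J \<noteq> {} \<and> card J = card (\<Union>(F ` J))")
    case True
    then obtain J where J: "J \<subset> A" "J \<noteq> {}" "card J = card (\<Union>(F ` J))" by blast
    have finJ: "finite J" using J(1) fin(1) finite_subset by blast
    have "\<exists>h. inj_on h J \<and> (\<forall>a\<in>J. h a \<in> F a)"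
      by (rule less.hyps) (use J fin hall finJ psubset_card_mono[OF fin(1) J(1)] in \<open>auto\<close>)
    then obtain h1 where h1: "inj_on h1 J" "\<forall>a\<in>J. h1 a \<in> F a" by blast
    define G where "G a = F a - \<Union>(F ` J)" for a
    have "\<exists>h. inj_on h (A - J) \<and> (\<forall>a\<in>A - J. h a \<in> G a)"
    proof (rule less.hyps)
      show "card (A - J) < card A" using J fin(1) by (intro psubset_card_mono) auto
      fix K assume K: "K \<subseteq> A - J"
      have KJ: "K \<union> J \<subseteq> A" "K \<inter> J = {}" "finite K"
        using K J fin(1) finite_subset by auto
      \<comment> \<open>Hall's condition for \<open>K \<union> J\<close> minus the tight equality
        for \<open>J\<close> leaves Hall's condition for \<open>K\<close> and
        \<open>G\<close>.\<close>
      have "card K + card J = card (K \<union> J)" using KJ finJ by (simp add: card_Un_disjoint)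
      also have "\<dots> \<le> card (\<Union>(F ` (K \<union> J)))" using hall KJ by blast
      also have "\<Union>(F ` (K \<union> J)) = \<Union>(G ` K) \<union> \<Union>(F ` J)" unfolding G_def by auto
      also have "card \<dots> \<le> card (\<Union>(G ` K)) + card (\<Union>(F ` J))" by (rule card_Un_le)
      finally show "card K \<le> card (\<Union>(G ` K))" using J(3) by simp
    qed (use fin in \<open>auto simp: G_def\<close>)
    then obtain h2 where h2: "inj_on h2 (A - J)" "\<forall>a\<in>A - J. h2 a \<in> G a" by blast
    define h where "h a = (if a \<in> J then h1 a else h2 a)" for a
    have "inj_on h A"
    proof (rule inj_onI)
      fix x y assume xy: "x \<in> A" "y \<in> A" "h x = h y"
      have *: "h1 u \<noteq> h2 v" if "u \<in> J" "v \<in> A - J" for u v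
      proof -
        have "h1 u \<in> \<Union>(F ` J)" using h1(2) that(1) by blast
        moreover have "h2 v \<notin> \<Union>(F ` J)" using h2(2) that(2) by (simp add: G_def)
        ultimately show ?thesis by metis
      qed
      show "x = y"
      proof (cases "x \<in> J"; cases "y \<in> J")
        assume "x \<in> J" "y \<in> J"
        then show ?thesis using xy h1(1) by (simp add: h_def inj_on_eq_iff)
      next
        assume "x \<notin> J" "y \<notin> J"
        then show ?thesis using xy h2(1) by (simp add: h_def inj_on_eq_iff)
      next
        assume "x \<in> J" "y \<notin> J"
        then show ?thesis using xy *[of x y] by (simp add: h_def)
      next
        assume "x \<notin> J" "y \<in> J"
        then show ?thesis using xy *[of y x] by (simp add: h_def)
      qed
    qed
    moreover have "\<forall>a\<in>A. h a \<in> F a" using h1(2) h2(2) unfolding h_def G_def by auto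
    ultimately show ?thesis by blast
  next
    case False
    show ?thesis
    proof (cases "A = {}")
      case True then show ?thesis by simp
    next
      case False': False
      then obtain a where a: "a \<in> A" by blast
      have "card {a} \<le> card (\<Union>(F ` {a}))" using hall a by blast
      then have "F a \<noteq> {}" by auto
      then obtain y where y: "y \<in> F a" by blast
      have "\<exists>h. inj_on h (A - {a}) \<and> (\<forall>b\<in>A - {a}. h b \<in> F b - {y})"
      proof (rule less.hyps)
        show "card (A - {a}) < card A" using a fin(1) by (intro psubset_card_mono) auto
        fix K assume K: "K \<subseteq> A - {a}"
        show "card K \<le> card (\<Union>((\<lambda>b. F b - {y}) ` K))"
        proof (cases "K = {}")
          case False
          have "K \<subset> A" using K a by auto
          then have "card K \<noteq> card (\<Union>(F ` K))" using False \<open>\<not> (\<exists>J. _ J)\<close> by blast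
          moreover have "card K \<le> card (\<Union>(F ` K))" using hall \<open>K \<subset> A\<close> by blast
          ultimately have "card K < card (\<Union>(F ` K))" by simp
          moreover have "\<Union>((\<lambda>b. F b - {y}) ` K) = \<Union>(F ` K) - {y}" by auto
          moreover have "card (\<Union>(F ` K)) - 1 \<le> card (\<Union>(F ` K) - {y})"
            using finU[of K] \<open>K \<subset> A\<close> by (simp add: card_Diff_singleton_if)
          ultimately show ?thesis by simp
        qed simp
      qed (use fin in auto)
      then obtain h where h: "inj_on h (A - {a})" "\<forall>b\<in>A - {a}. h b \<in> F b - {y}" by blast
      have "inj_on (h(a := y)) A" using h unfolding inj_on_def by auto
      moreover have "\<forall>b\<in>A. (h(a := y)) b \<in> F b" using h y by auto
      ultimately show ?thesis by blast
    qed
  qed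
qed

text \<open>\<open>coupling Q C x\<close> is the probability that adding each \<open>p \<in> Q\<close> not dividing \<open>x\<close> independently with
  probability \<open>coin p\<close> to \<open>{p \<in> Q. p dvd x}\<close> yields \<open>C\<close>.\<close>

definition coin :: "nat \<Rightarrow> real" where
  "coin p = (real p - 2) / (2 * (real p - 1))"

definition coupling :: "nat set \<Rightarrow> nat set \<Rightarrow> nat \<Rightarrow> real" where
  "coupling Q C x = (\<Prod>p\<in>Q. if p \<in> C then (if p dvd x then 1 else coin p)
                                      else (if p dvd x then 0 else 1 - coin p))"

text \<open>The extreme \<open>1/4\<close> is \<open>coin 3\<close>. Both outcomes of every coin
  thus have probability at least \<open>1/4\<close>, which is what
  \<open>coupling_coprime_ge\<close> rests on.\<close>

lemma coin_bounds: "1/4 \<le> coin p" "coin p \<le> 1/2" if "p \<ge> 3"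
  using that by (auto simp: coin_def field_simps)

lemma prod_if_member:
  fixes f g :: "'a \<Rightarrow> 'b::comm_monoid_mult"
  assumes "finite Q" "C \<subseteq> Q"
  shows "(\<Prod>p\<in>Q. if p \<in> C then f p else g p) = (\<Prod>p\<in>C. f p) * (\<Prod>p\<in>Q - C. g p)"
proof -
  have "Q \<inter> {p. p \<in> C} = C" "Q \<inter> - {p. p \<in> C} = Q - C" using assms(2) by auto
  then show ?thesis using prod.If_cases[OF assms(1), of "\<lambda>p. p \<in> C" f g] by simp
qed

text \<open>Total probability: the two branch weights at each \<open>p\<close> add up to 1, and
  multiplying out the product of these sums runs over all \<open>C\<close>.\<close>

lemma sum_coupling_eq_1:
  assumes "finite Q"
  shows "(\<Sum>C\<in>Pow Q. coupling Q C x) = 1"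
proof -
  let ?f = "\<lambda>p. if p dvd x then 1 else coin p" and ?g = "\<lambda>p. if p dvd x then 0 else 1 - coin p"
  have "(\<Sum>C\<in>Pow Q. coupling Q C x) = (\<Sum>C\<in>Pow Q. prod ?f C * prod ?g (Q - C))"
    unfolding coupling_def using prod_if_member[OF assms] by (intro sum.cong) auto
  also have "\<dots> = (\<Prod>p\<in>Q. ?f p + ?g p)" by (rule prod_add[OF assms, symmetric])
  also have "\<dots> = 1" by (intro prod.neutral) auto
  finally show ?thesis .
qed

lemma coupling_nonneg: "0 \<le> coupling Q C x" if "\<And>p. p \<in> Q \<Longrightarrow> p \<ge> 3"
  unfolding coupling_def
proof (intro prod_nonneg ballI)
  fix p assume "p \<in> Q"
  then show "0 \<le> (if p \<in> C then if p dvd x then 1 else coin p else if p dvd x then 0 else 1 - coin p)"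
    using coin_bounds[of p] that by auto
qed

lemma coupling_le_1: "coupling Q C x \<le> 1" if "\<And>p. p \<in> Q \<Longrightarrow> p \<ge> 3"
  unfolding coupling_def
proof (intro prod_le_1)
  fix p assume "p \<in> Q"
  then show "0 \<le> (if p \<in> C then if p dvd x then 1 else coin p else if p dvd x then 0 else 1 - coin p) \<and>
    (if p \<in> C then if p dvd x then 1 else coin p else if p dvd x then 0 else 1 - coin p) \<le> 1"
    using coin_bounds[of p] that by auto
qed

lemma coupling_eq_0:
  assumes "finite Q" "p \<in> Q" "p \<notin> C" "p dvd x"
  shows "coupling Q C x = 0"
  unfolding coupling_def using assms by (intro prod_zero) auto

lemma coupling_coprime_ge:
  assumes "\<And>p. p \<in> Q \<Longrightarrow> p \<ge> 3" "\<And>p. p \<in> Q \<Longrightarrow> \<not> p dvd x"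
  shows "(1/4) ^ card Q \<le> coupling Q C x"
proof -
  have "(\<Prod>p\<in>Q. 1/4) \<le> coupling Q C x"
    unfolding coupling_def
  proof (rule prod_mono)
    fix p assume "p \<in> Q"
    then show "0 \<le> (1/4 :: real) \<and> 1/4 \<le> (if p \<in> C then if p dvd x then 1 else coin p
      else if p dvd x then 0 else 1 - coin p)"
      using coin_bounds[of p] assms by auto
  qed
  then show ?thesis by simp
qed

section \<open>Averages of the coupling over arithmetic progressions\<close>

lemma ex1_dvd_progression:
  fixes a b p :: nat
  assumes "prime p" "coprime b p"
  shows "\<exists>!v. v < p \<and> p dvd a + b * v"
proof -
  \<comment> \<open>Since \<open>b\<close> is invertible modulo \<open>p\<close>,
    \<open>a + b * v\<close> runs through all residues, so 0 is hit exactly once.\<close>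
  have inj: "inj_on (\<lambda>v. (a + b * v) mod p) {..<p}"
  proof (rule linorder_inj_onI)
    fix u v assume uv: "u < v" "u \<in> {..<p}" "v \<in> {..<p}"
    show "(a + b * u) mod p \<noteq> (a + b * v) mod p"
    proof
      assume "(a + b * u) mod p = (a + b * v) mod p"
      then have "p dvd (a + b * v) - (a + b * u)"
        using uv(1) mod_eq_dvd_iff_nat[of "a + b * u" "a + b * v" p] by simp
      then have "p dvd b * (v - u)" by (simp add: diff_mult_distrib2)
      then have "p dvd v - u" using assms(2) by (simp add: coprime_commute coprime_dvd_mult_right_iff)
      then have "p \<le> v - u" using uv(1) by (intro dvd_imp_le) auto
      then show False using uv by auto
    qed
  qed auto
  have "(\<lambda>v. (a + b * v) mod p) ` {..<p} = {..<p}"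
    using prime_gt_0_nat[OF assms(1)] by (intro endo_inj_surj inj) auto
  then have "0 \<in> (\<lambda>v. (a + b * v) mod p) ` {..<p}" using prime_gt_0_nat[OF assms(1)] by auto
  then obtain v where v: "v < p" "(a + b * v) mod p = 0" by auto
  show ?thesis
  proof (rule ex1I[of _ v])
    fix u assume u: "u < p \<and> p dvd a + b * u"
    then have "(a + b * u) mod p = (a + b * v) mod p"
      unfolding v(2) by (intro dvd_imp_mod_0) blast
    then show "u = v" by (rule inj_onD[OF inj]) (use u v in \<open>simp_all only: lessThan_iff\<close>)
  next
    show "v < p \<and> p dvd a + b * v" using v by (simp only: dvd_eq_mod_eq_0)
  qed
qed

lemma sum_if_dvd_progression:
  fixes u v :: real and p :: nat
  assumes "prime p" "coprime b p"
  shows "(\<Sum>t<p. if p dvd a + b * t then u else v) = u + (real p - 1) * v"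
proof -
  obtain w where w: "w < p" "\<And>t. t < p \<Longrightarrow> p dvd a + b * t \<longleftrightarrow> t = w"
    using ex1_dvd_progression[OF assms, of a] by metis
  have "(\<Sum>t<p. if p dvd a + b * t then u else v) = (\<Sum>t<p. v + (if t = w then u - v else 0))"
    using w by (intro sum.cong) auto
  also have "\<dots> = real p * v + (u - v)" using w(1) by (simp add: sum.distrib)
  finally show ?thesis by (simp add: algebra_simps)
qed

lemma sum_lessThan_prod_nat:
  fixes f :: "nat \<Rightarrow> 'a::comm_monoid_add"
  shows "(\<Sum>t<m * k. f t) = (\<Sum>u<k. \<Sum>v<m. f (u + k * v))"
proof -
  have "(\<Sum>t<m * k. f t) = (\<Sum>v<m. sum f {v * k..<v * k + k})"
    by (rule sum.nat_group[symmetric])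
  also have "\<dots> = (\<Sum>v<m. \<Sum>u<k. f (u + k * v))"
  proof (rule sum.cong[OF refl])
    fix v
    have "sum f {0 + v * k..<k + v * k} = (\<Sum>u = 0..<k. f (u + v * k))"
      by (rule sum.shift_bounds_nat_ivl)
    then show "sum f {v * k..<v * k + k} = (\<Sum>u<k. f (u + k * v))"
      by (simp add: atLeast0LessThan add.commute mult.commute)
  qed
  finally show ?thesis by (subst (asm) sum.swap)
qed

text \<open>The biases \<open>coin p\<close> are chosen so that every \<open>C\<close> receives the same total weight over
  a full period.\<close>

lemma sum_coupling_period:
  assumes "finite Q" "\<And>p. p \<in> Q \<Longrightarrow> prime p \<and> p \<ge> 3 \<and> coprime b p"
  shows "(\<Sum>t<\<Prod>Q. coupling Q C (a + b * t)) = real (\<Prod>Q) / 2 ^ card Q"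
  using assms
proof (induction Q)
  case empty
  then show ?case by (simp add: coupling_def)
next
  case (insert p Q)
  have p: "prime p" "p \<ge> 3" "coprime b p" using insert.prems by auto
  let ?M = "\<Prod>Q"
  let ?h = "\<lambda>x. if p \<in> C then (if p dvd x then 1 else coin p)
                      else (if p dvd x then 0 else 1 - coin p)"
  have copM: "coprime ?M p"
    using insert.hyps insert.prems by (intro prod_coprime_left) (metis insertCI primes_coprime)
  \<comment> \<open>With \<open>t = u + ?M * v\<close> the factors at the primes of \<open>Q\<close>
    depend on \<open>u\<close> only, so the sum over \<open>v\<close> concerns the factor at
    \<open>p\<close> alone.\<close>
  have per: "coupling Q C (a + b * (u + ?M * v)) = coupling Q C (a + b * u)" for u v
  proof -
    have "q dvd a + b * (u + ?M * v) \<longleftrightarrow> q dvd a + b * u" if "q \<in> Q" for q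
    proof -
      have "q dvd ?M" using that insert.hyps(1) by (metis dvd_prodI)
      then have "q dvd b * (?M * v)" by simp
      then show ?thesis by (simp add: add_mult_distrib2 add.assoc[symmetric] dvd_add_left_iff)
    qed
    then show ?thesis unfolding coupling_def by (intro prod.cong) auto
  qed
  \<comment> \<open>Exactly one \<open>v\<close> gives a multiple of \<open>p\<close>. Both
    \<open>1 + (p - 1) * coin p\<close> and \<open>(p - 1) * (1 - coin p)\<close> equal
    \<open>p / 2\<close>, so it makes no difference whether \<open>p\<close> lies in
    \<open>C\<close>.\<close>
  have hs: "(\<Sum>v<p. ?h (a + b * (u + ?M * v))) = real p / 2" for u
  proof -
    have cop: "coprime (b * ?M) p" using p(3) copM by simp
    have "(\<Sum>v<p. ?h (a + b * (u + ?M * v))) =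
        (\<Sum>v<p. if p dvd (a + b * u) + (b * ?M) * v then (if p \<in> C then 1 else 0)
               else (if p \<in> C then coin p else 1 - coin p))"
      by (intro sum.cong) (auto simp: algebra_simps)
    also have "\<dots> = real p / 2"
      unfolding sum_if_dvd_progression[OF p(1) cop] using p(2) by (auto simp: coin_def field_simps)
    finally show ?thesis .
  qed
  have "(\<Sum>t<\<Prod>(insert p Q). coupling (insert p Q) C (a + b * t)) =
      (\<Sum>t<p * ?M. ?h (a + b * t) * coupling Q C (a + b * t))"
    using insert.hyps by (simp add: coupling_def)
  also have "\<dots> = (\<Sum>u<?M. \<Sum>v<p. ?h (a + b * (u + ?M * v)) * coupling Q C (a + b * u))"
    by (subst sum_lessThan_prod_nat) (simp add: per)
  also have "\<dots> = (\<Sum>u<?M. real p / 2 * coupling Q C (a + b * u))"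
    by (simp only: sum_distrib_right[symmetric] hs)
  also have "\<dots> = real p / 2 * (real ?M / 2 ^ card Q)"
    unfolding sum_distrib_left[symmetric] using insert by simp
  finally show ?case using insert.hyps by simp
qed

text \<open>The multiples of \<open>d\<close> sit at indices \<open>i0 + d * t\<close>, so they
  again form a progression whose step \<open>c * d\<close> is prime to every
  \<open>p \<in> Q\<close>, and \<open>sum_coupling_period\<close> applies. Rounding up to whole
  periods costs at most one period, whence the summand \<open>\<Prod>Q\<close>.\<close>

lemma sum_coupling_multiples:
  assumes "finite Q" "\<And>p. p \<in> Q \<Longrightarrow> prime p \<and> p \<ge> 3 \<and> coprime c p \<and> coprime d p"
    and "d > 0" "coprime d c"
  shows "(\<Sum>i | i < N \<and> d dvd 1 + c * i. coupling Q C (1 + c * i)) \<le>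
    (real N / real d + real (\<Prod>Q)) / 2 ^ card Q"
proof (cases "\<exists>i. d dvd 1 + c * i")
  case False
  then have "{i. i < N \<and> d dvd 1 + c * i} = {}" by auto
  then show ?thesis by (simp only:) (simp add: prod_nonneg)
next
  case True
  define i0 where "i0 = (LEAST i. d dvd 1 + c * i)"
  have i0: "d dvd 1 + c * i0" "\<And>i. d dvd 1 + c * i \<Longrightarrow> i0 \<le> i"
    unfolding i0_def using True by (auto intro: LeastI_ex Least_le)
  \<comment> \<open>\<open>B\<close> periods of length \<open>M\<close> in \<open>t\<close> reach
    past \<open>N\<close> because \<open>N < d * M * B\<close>, while
    \<open>B - 1 \<le> N / (d * M)\<close>.\<close>
  define M B where "M = \<Prod>Q" and "B = N div (d * M) + 1"
  have M: "M > 0" unfolding M_def using assms(2) by (intro prod_pos) (metis gr0I not_numeral_le_zero)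
  have "N < d * M * B"
    using M \<open>d > 0\<close> unfolding B_def
    by (metis Suc_eq_plus1 dividend_less_times_div mult_pos_pos mult_Suc_right add.commute)
  have sub: "{i. i < N \<and> d dvd 1 + c * i} \<subseteq> (\<lambda>t. i0 + d * t) ` {..<B * M}"
  proof
    fix i assume "i \<in> {i. i < N \<and> d dvd 1 + c * i}"
    then have i: "i < N" "d dvd 1 + c * i" "i0 \<le> i" using i0(2) by auto
    have "d dvd (1 + c * i) - (1 + c * i0)" using i(2) i0(1) by (rule dvd_diff_nat)
    then have "d dvd c * (i - i0)" by (simp add: diff_mult_distrib2)
    then have "d dvd i - i0" using assms(4) by (simp add: coprime_dvd_mult_right_iff)
    then obtain t where t: "i - i0 = d * t" by blast
    have "d * t \<le> i" unfolding t[symmetric] by simp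
    also note i(1)
    also note \<open>N < d * M * B\<close>
    finally have "t < B * M" by (simp add: mult_ac)
    then show "i \<in> (\<lambda>t. i0 + d * t) ` {..<B * M}" using t i(3) by (intro image_eqI[of _ _ t]) auto
  qed
  have nn: "0 \<le> coupling Q C x" for x using coupling_nonneg assms(2) by blast
  have "(\<Sum>i | i < N \<and> d dvd 1 + c * i. coupling Q C (1 + c * i)) \<le>
      (\<Sum>i\<in>(\<lambda>t. i0 + d * t) ` {..<B * M}. coupling Q C (1 + c * i))"
    by (intro sum_mono2 sub) (auto intro: nn)
  also have "\<dots> = (\<Sum>t<B * M. coupling Q C (1 + c * (i0 + d * t)))"
    using \<open>d > 0\<close> by (subst sum.reindex) (auto simp: inj_on_def)
  also have "\<dots> = (\<Sum>v<B. \<Sum>u<M. coupling Q C (1 + c * (i0 + d * (u + M * v))))"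
    by (subst sum_lessThan_prod_nat) (rule sum.swap)
  also have "\<dots> = (\<Sum>v<B. real M / 2 ^ card Q)"
  proof (rule sum.cong[OF refl])
    fix v
    have "(\<Sum>u<M. coupling Q C (1 + c * (i0 + d * (u + M * v)))) =
      (\<Sum>u<M. coupling Q C ((1 + c * i0 + c * d * M * v) + (c * d) * u))"
      by (simp add: algebra_simps)
    also have "\<dots> = real M / 2 ^ card Q"
      unfolding M_def using assms(2) by (intro sum_coupling_period assms(1)) auto
    finally show "(\<Sum>u<M. coupling Q C (1 + c * (i0 + d * (u + M * v)))) = real M / 2 ^ card Q" .
  qed
  also have "\<dots> = real B * real M / 2 ^ card Q" by simp
  also have "\<dots> \<le> (real N / real d + real M) / 2 ^ card Q"
  proof (rule divide_right_mono)
    have "real (N div (d * M)) \<le> real N / real (d * M)" by (rule of_nat_div_le_of_nat)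
    then have "real (N div (d * M)) * real M \<le> real N / real d"
      using M \<open>d > 0\<close> by (simp add: field_simps)
    then show "real B * real M \<le> real N / real d + real M" by (simp add: B_def algebra_simps)
  qed simp
  finally show ?thesis by (simp add: M_def)
qed

text \<open>The cofactor \<open>(1 + c * i) div d\<close> determines \<open>i\<close> and lies
  between 1 and \<open>2 * N div d\<close>. A factor 2 replaces the additive error, so the bound
  stays proportional to \<open>1 / d\<close> even for \<open>d > N\<close>.\<close>

lemma card_multiples_le:
  assumes "d > 0" "0 < c" "c \<le> 2"
  shows "real (card {i. i < N \<and> d dvd 1 + c * i}) \<le> 2 * real N / real d"
proof -
  let ?A = "{i. i < N \<and> d dvd 1 + c * i}"
  have "card ?A \<le> card {1..2 * N div d}"
  proof (rule card_inj_on_le)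
    show "inj_on (\<lambda>i. (1 + c * i) div d) ?A"
    proof (rule inj_onI)
      fix i j assume ij: "i \<in> ?A" "j \<in> ?A" "(1 + c * i) div d = (1 + c * j) div d"
      then have "1 + c * i = 1 + c * j" by (metis (no_types, lifting) dvd_div_mult_self mem_Collect_eq)
      then show "i = j" using assms by simp
    qed
    show "(\<lambda>i. (1 + c * i) div d) ` ?A \<subseteq> {1..2 * N div d}"
    proof safe
      fix i assume i: "i < N" "d dvd 1 + c * i"
      have "c * i \<le> 2 * i" using assms by simp
      then have "1 + c * i \<le> 2 * N" using i(1) by linarith
      then show "(1 + c * i) div d \<in> {1..2 * N div d}"
        using i(2) assms(1) by (auto intro!: div_le_mono simp: Suc_le_eq dvd_imp_le div_greater_zero_iff)
    qed
  qed simp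
  then have "card ?A \<le> 2 * N div d" by simp
  then have "real (card ?A) \<le> real (2 * N div d)" by simp
  also have "\<dots> \<le> real (2 * N) / real d" by (rule of_nat_div_le_of_nat)
  finally show ?thesis by simp
qed

section \<open>Elementary symmetric sums and counting of supersets\<close>

lemma power_add_ge:
  fixes s x :: real
  assumes "0 \<le> s" "0 \<le> x"
  shows "s ^ Suc r + real (Suc r) * x * s ^ r \<le> (s + x) ^ Suc r"
proof (induction r)
  case (Suc r)
  have "s ^ Suc (Suc r) + real (Suc (Suc r)) * x * s ^ Suc r \<le>
      (s + x) * (s ^ Suc r + real (Suc r) * x * s ^ r)"
    using assms by (simp add: algebra_simps)
  also have "\<dots> \<le> (s + x) * (s + x) ^ Suc r" using Suc assms by (intro mult_left_mono) auto
  finally show ?case by simp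
qed simp

text \<open>The left side is the elementary symmetric polynomial of degree \<open>r\<close>. In the
  induction it splits according to whether \<open>D\<close> contains the new element;
  \<open>power_add_ge\<close>, two terms of the binomial expansion, closes the step.\<close>

lemma sum_prod_subsets_le:
  fixes x :: "'a \<Rightarrow> real"
  assumes "finite A" "\<And>a. a \<in> A \<Longrightarrow> 0 \<le> x a"
  shows "(\<Sum>D | D \<subseteq> A \<and> card D = r. prod x D) \<le> sum x A ^ r / fact r"
  using assms
proof (induction A arbitrary: r)
  case empty
  have "{D::'a set. D \<subseteq> {} \<and> card D = r} = (if r = 0 then {{}} else {})" by auto
  then show ?case by (simp only:) simp
next
  case (insert a A)
  show ?case
  proof (cases r)
    case 0
    have "{D. D \<subseteq> insert a A \<and> card D = 0} = {{}}"
      using insert.hyps(1) finite_subset by (auto simp: card_eq_0_iff)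
    then show ?thesis using 0 by simp
  next
    case (Suc k)
    let ?F = "\<lambda>k. {D. D \<subseteq> A \<and> card D = k}"
    have fin: "finite (?F k)" for k using insert.hyps(1) by simp
    have "{D. D \<subseteq> insert a A \<and> card D = Suc k} = ?F (Suc k) \<union> insert a ` ?F k"
    proof (intro equalityI subsetI)
      fix D assume D: "D \<in> {D. D \<subseteq> insert a A \<and> card D = Suc k}"
      show "D \<in> ?F (Suc k) \<union> insert a ` ?F k"
      proof (cases "a \<in> D")
        case True
        then have "D = insert a (D - {a})" "D - {a} \<in> ?F k" using D by auto
        then show ?thesis by blast
      qed (use D in auto)
    next
      fix D assume "D \<in> ?F (Suc k) \<union> insert a ` ?F k"
      then show "D \<in> {D. D \<subseteq> insert a A \<and> card D = Suc k}"
      proof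
        assume "D \<in> insert a ` ?F k"
        then obtain B where B: "D = insert a B" "B \<subseteq> A" "card B = k" by blast
        then have "finite B" "a \<notin> B" using insert.hyps finite_subset by auto
        then show ?thesis using B by auto
      qed auto
    qed
    then have "(\<Sum>D | D \<subseteq> insert a A \<and> card D = Suc k. prod x D) =
        (\<Sum>D\<in>?F (Suc k). prod x D) + (\<Sum>D\<in>insert a ` ?F k. prod x D)"
      using fin insert.hyps(2) by (simp add: sum.union_disjoint disjoint_iff) (subst sum.union_disjoint; auto)
    also have "(\<Sum>D\<in>insert a ` ?F k. prod x D) = (\<Sum>D\<in>?F k. prod x (insert a D))"
      using insert.hyps(2) by (intro sum.reindex[unfolded o_def]) (auto simp: inj_on_def)
    also have "\<dots> = x a * (\<Sum>D\<in>?F k. prod x D)"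
      unfolding sum_distrib_left
    proof (rule sum.cong[OF refl])
      fix D assume "D \<in> ?F k"
      then show "prod x (insert a D) = x a * prod x D"
        using insert.hyps finite_subset[of D A] by (subst prod.insert) auto
    qed
    also have "(\<Sum>D\<in>?F (Suc k). prod x D) + x a * (\<Sum>D\<in>?F k. prod x D) \<le>
        sum x A ^ Suc k / fact (Suc k) + x a * (sum x A ^ k / fact k)"
      by (intro add_mono mult_left_mono insert.IH) (use insert.prems in auto)
    also have "\<dots> = (sum x A ^ Suc k + real (Suc k) * x a * sum x A ^ k) / fact (Suc k)"
      by (simp add: divide_simps add_eq_0_iff)
    also have "\<dots> \<le> (sum x A + x a) ^ Suc k / fact (Suc k)"
      using insert.prems by (intro divide_right_mono power_add_ge sum_nonneg) auto
    finally show ?thesis using insert.hyps Suc by (simp add: add.commute)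
  qed
qed

lemma sum_le_sum_cover:
  fixes w :: "'a \<Rightarrow> real"
  assumes "finite K" "\<And>k. k \<in> K \<Longrightarrow> finite (I k)" "A \<subseteq> (\<Union>k\<in>K. I k)" "\<And>i. 0 \<le> w i"
  shows "sum w A \<le> (\<Sum>k\<in>K. sum w (I k))"
proof -
  have "sum w A \<le> sum w (\<Union>k\<in>K. I k)" using assms by (intro sum_mono2) auto
  also have "\<dots> \<le> (\<Sum>k\<in>K. sum w (I k))" using assms(1,2)
  proof induction
    case (insert k K)
    have "sum w (I k \<union> (\<Union>k\<in>K. I k)) \<le> sum w (I k) + sum w (\<Union>k\<in>K. I k)"
      using insert assms(4) by (subst sum.union_inter[symmetric]) (auto intro: sum_nonneg)
    then show ?case using insert by simp
  qed simp
  finally show ?thesis .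
qed

lemma card_supersets:
  assumes "finite P" "A \<subseteq> P"
  shows "real (card {B. A \<subseteq> B \<and> B \<subseteq> P}) = 2 ^ card P / 2 ^ card A"
proof -
  have "bij_betw (\<lambda>B. A \<union> B) (Pow (P - A)) {B. A \<subseteq> B \<and> B \<subseteq> P}"
    by (rule bij_betwI[where g = "\<lambda>B. B - A"]) (use assms in auto)
  then have "card {B. A \<subseteq> B \<and> B \<subseteq> P} = 2 ^ card (P - A)"
    using assms by (simp add: bij_betw_same_card[symmetric] card_Pow)
  moreover have "card P = card (P - A) + card A"
    using assms card_mono[of P A] finite_subset[of A P] by (simp add: card_Diff_subset)
  ultimately show ?thesis by (simp add: power_add)
qed

lemma prod_primes_dvd_iff:
  fixes D :: "nat set"
  assumes "finite D" "\<And>p. p \<in> D \<Longrightarrow> prime p"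
  shows "\<Prod>D dvd n \<longleftrightarrow> (\<forall>p\<in>D. p dvd n)"
  using assms
proof induction
  case (insert p D)
  have "coprime p (\<Prod>D)"
    using insert by (intro prod_coprime_right) (metis insertCI primes_coprime)
  then have "p * \<Prod>D dvd n \<longleftrightarrow> p dvd n \<and> \<Prod>D dvd n"
    by (meson divides_mult dvd_mult_left dvd_mult_right)
  then show ?case using insert by simp
qed simp

text \<open>Inclusion-exclusion: two distinct sets of size \<open>r\<close> have a union of at least
  \<open>r + 1\<close> elements, so the common supersets are at most half of either family, and
  \<open>2 - 1/2 = 3/2\<close>.\<close>

lemma card_two_supersets:
  assumes "finite P" "A \<subseteq> P" "A' \<subseteq> P" "A \<noteq> A'" "card A = r" "card A' = r"
  shows "3 / 2 * (2 ^ card P / 2 ^ r) \<le> real (card {B. (A \<subseteq> B \<or> A' \<subseteq> B) \<and> B \<subseteq> P})"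
proof -
  let ?X = "\<lambda>A. {B. A \<subseteq> B \<and> B \<subseteq> P}"
  have fin: "finite A" "finite A'" using assms finite_subset by auto
  have "\<not> A' \<subseteq> A" using card_subset_eq[OF fin(1), of A'] assms by auto
  then have "A \<subset> A \<union> A'" by auto
  then have "card A < card (A \<union> A')" using fin by (intro psubset_card_mono) auto
  then have "(2::real) ^ Suc r \<le> 2 ^ card (A \<union> A')" using assms(5) by (intro power_increasing) auto
  then have "real (card (?X (A \<union> A'))) \<le> 2 ^ card P / 2 ^ Suc r"
    using assms by (subst card_supersets) (auto intro!: divide_left_mono)
  moreover have ie: "card (?X A \<union> ?X A') + card (?X A \<inter> ?X A') = card (?X A) + card (?X A')"
    using assms(1) by (intro card_Un_Int[symmetric]) auto
  have "real (card (?X A \<union> ?X A')) + real (card (?X A \<inter> ?X A')) =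
      real (card (?X A)) + real (card (?X A'))"
    using arg_cong[OF ie, of real] by (simp only: of_nat_add)
  then have "real (card (?X A \<union> ?X A')) + real (card (?X A \<inter> ?X A')) =
      2 ^ card P / 2 ^ r + 2 ^ card P / 2 ^ r"
    unfolding card_supersets[OF assms(1,2)] card_supersets[OF assms(1,3)] assms(5,6) .
  moreover have "?X A \<inter> ?X A' = ?X (A \<union> A')" by auto
  moreover have "?X A \<union> ?X A' = {B. (A \<subseteq> B \<or> A' \<subseteq> B) \<and> B \<subseteq> P}" by auto
  ultimately show ?thesis by (simp add: field_simps)
qed

text \<open>Passing from \<open>r\<close> to \<open>r + 1\<close> multiplies by
  \<open>x / (r + 1)\<close>, at most 1 once \<open>r \<ge> k \<ge> x\<close>.\<close>

lemma power_div_fact_antimono: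
  fixes x :: real
  assumes "0 \<le> x" "x \<le> real k" "k \<le> r"
  shows "x ^ r / fact r \<le> x ^ k / fact k"
  using assms(3)
proof (induction r rule: dec_induct)
  case (step r)
  have "x ^ Suc r / fact (Suc r) = x / real (Suc r) * (x ^ r / fact r)" by (simp add: field_simps)
  also have "\<dots> \<le> 1 * (x ^ r / fact r)"
    using step assms by (intro mult_right_mono) (auto simp: divide_simps)
  finally show ?case using step by simp
qed simp

section \<open>Hall's condition\<close>

text \<open>\<open>P1\<close> holds the small primes, \<open>P2\<close> the large ones.
  \<open>err\<close> bounds the loss from incomplete periods for up to \<open>r0\<close> large prime
  divisors, \<open>tail\<close> takes over beyond \<open>r0\<close>, \<open>err1\<close> is the
  sharper bound for a single prime, and \<open>gain\<close> guarantees enough \<open>i\<close> with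
  \<open>1 + c * i\<close> prime to all of \<open>P1 \<union> P2\<close>.\<close>

locale sieve_data =
  fixes c m r0 :: nat and P1 P2 :: "nat set"
  assumes c: "0 < c" "c \<le> 2"
    and fin: "finite P1" "finite P2" and disj: "P1 \<inter> P2 = {}"
    and odd_primes: "\<And>p. p \<in> P1 \<union> P2 \<Longrightarrow> prime p \<and> p \<ge> 3"
    and card: "card P1 + card P2 = m"
    and P2_ge: "\<And>p. p \<in> P2 \<Longrightarrow> p \<ge> 17"
    and sum_P2: "(\<Sum>p\<in>P2. 1 / real p) \<le> 20 / 27"
    and r0: "r0 \<ge> 3"
    and err: "\<And>r. 1 \<le> r \<Longrightarrow> r \<le> r0 \<Longrightarrow> 5 * (2 ^ r * (m choose r) * \<Prod>P1) \<le> 2 * 2 ^ m"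
    and err1: "120 * m * \<Prod>P1 \<le> 2 ^ m"
    and tail: "\<And>r. r0 < r \<Longrightarrow> 2 * 2 ^ card P1 * (40 / 27) ^ r \<le> (fact r :: real)"
    and gain: "16 * 4 ^ card P1 * \<Prod>P1 \<le> 2 ^ m"
begin

definition N :: nat where "N = 2 ^ m"
definition M :: nat where "M = \<Prod>P1"
text \<open>Both the number of subsets of \<open>P2\<close> and, since
  \<open>N = 2 ^ card P1 * T\<close>, the average weight received by one
  \<open>C \<subseteq> P1\<close>.\<close>

definition T :: real where "T = 2 ^ card P2"
definition S1 :: "nat \<Rightarrow> nat set" where "S1 i = {p \<in> P1. p dvd 1 + c * i}"
definition S2 :: "nat \<Rightarrow> nat set" where "S2 i = {p \<in> P2. p dvd 1 + c * i}"
definition w :: "nat set \<Rightarrow> nat \<Rightarrow> real" where "w C i = coupling P1 C (1 + c * i)"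

lemma w_nonneg: "0 \<le> w C i" and w_le_1: "w C i \<le> 1"
  unfolding w_def using odd_primes by (auto intro: coupling_nonneg coupling_le_1)

lemma w_eq_0: "\<not> S1 i \<subseteq> C \<Longrightarrow> w C i = 0"
  unfolding w_def S1_def using fin coupling_eq_0 by blast

lemma T_N: "real N = 2 ^ card P1 * T"
  unfolding N_def T_def by (simp add: card[symmetric] power_add)

lemma T_pos: "T > 0" by (simp add: T_def)

lemma coprime_c: "p \<in> P1 \<union> P2 \<Longrightarrow> coprime c p"
  using odd_primes[of p] c
  by (metis coprime_commute dvd_imp_le le_antisym not_less_eq_eq numeral_2_eq_2 numeral_3_eq_3
      order_trans prime_imp_coprime)

lemma subset_S2_iff: "D \<subseteq> P2 \<Longrightarrow> D \<subseteq> S2 i \<longleftrightarrow> \<Prod>D dvd 1 + c * i"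
  using prod_primes_dvd_iff[of D] odd_primes finite_subset[OF _ fin(2), of D]
  unfolding S2_def by (subst prod_primes_dvd_iff) auto

lemma prod_P2_pos: "D \<subseteq> P2 \<Longrightarrow> \<Prod>D > 0"
  by (intro prod_pos) (use odd_primes in fastforce)

lemma sum_w_multiples:
  assumes "D \<subseteq> P2"
  shows "(\<Sum>i | i < N \<and> D \<subseteq> S2 i. w C i) \<le> (real N / real (\<Prod>D) + real M) / 2 ^ card P1"
  unfolding subset_S2_iff[OF assms] w_def M_def
proof (rule sum_coupling_multiples)
  fix p assume p: "p \<in> P1"
  have "coprime (\<Prod>D) p"
    by (intro prod_coprime_left)
       (metis IntI UnCI assms disj empty_iff odd_primes p primes_coprime subsetD)
  then show "prime p \<and> p \<ge> 3 \<and> coprime c p \<and> coprime (\<Prod>D) p"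
    using p odd_primes coprime_c by auto
next
  show "coprime (\<Prod>D) c"
    by (intro prod_coprime_left) (use assms coprime_c coprime_commute in blast)
qed (use fin prod_P2_pos[OF assms] in auto)

lemma sum_w_multiples':
  assumes "D \<subseteq> P2"
  shows "(\<Sum>i | i < N \<and> D \<subseteq> S2 i. w C i) \<le> 2 * real N / real (\<Prod>D)"
proof -
  have "(\<Sum>i | i < N \<and> D \<subseteq> S2 i. w C i) \<le> (\<Sum>i | i < N \<and> D \<subseteq> S2 i. 1)"
    by (intro sum_mono w_le_1)
  also have "\<dots> = real (card {i. i < N \<and> \<Prod>D dvd 1 + c * i})"
    by (simp add: subset_S2_iff[OF assms])
  finally show ?thesis
    using card_multiples_le[OF prod_P2_pos[OF assms] c, of N] by linarith
qed

lemma sum_w_all: "(\<Sum>i<N. w C i) \<le> (real N + real M) / 2 ^ card P1"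
  using sum_w_multiples[of "{}" C] by (simp add: lessThan_def)

text \<open>In \<open>E_le\<close> the error from incomplete periods grows with the number of products of \<open>r\<close> primes;
  for large \<open>r\<close> it is cheaper to give up the equidistribution, as in \<open>E_le'\<close>.\<close>

definition E :: "nat set \<Rightarrow> nat \<Rightarrow> real" where
  "E C r = (\<Sum>i | i < N \<and> r \<le> card (S2 i). w C i)"

text \<open>Union bound: an index with at least \<open>r\<close> large primes is counted for some
  \<open>r\<close>-subset \<open>D\<close> of them.\<close>

lemma E_le_sum: "E C r \<le> (\<Sum>D | D \<subseteq> P2 \<and> card D = r. \<Sum>i | i < N \<and> D \<subseteq> S2 i. w C i)"
  unfolding E_def
proof (rule sum_le_sum_cover)
  show "{i. i < N \<and> r \<le> card (S2 i)} \<subseteq> (\<Union>D\<in>{D. D \<subseteq> P2 \<and> card D = r}. {i. i < N \<and> D \<subseteq> S2 i})"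
  proof
    fix i assume i: "i \<in> {i. i < N \<and> r \<le> card (S2 i)}"
    then obtain D where D: "D \<subseteq> S2 i" "card D = r"
      using obtain_subset_with_card_n[of r "S2 i"] by auto
    moreover have "D \<subseteq> P2" using D by (auto simp: S2_def)
    ultimately show "i \<in> (\<Union>D\<in>{D. D \<subseteq> P2 \<and> card D = r}. {i. i < N \<and> D \<subseteq> S2 i})"
      using i by (intro UN_I[of D]) auto
  qed
qed (use fin w_nonneg in auto)

lemma sum_inverse_prod_le:
  "(\<Sum>D | D \<subseteq> P2 \<and> card D = r. 1 / real (\<Prod>D)) \<le> (20 / 27) ^ r / fact r"
proof -
  have "(\<Sum>D | D \<subseteq> P2 \<and> card D = r. 1 / real (\<Prod>D)) =
      (\<Sum>D | D \<subseteq> P2 \<and> card D = r. \<Prod>p\<in>D. 1 / real p)"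
    by (simp add: prod_dividef)
  also have "\<dots> \<le> (\<Sum>p\<in>P2. 1 / real p) ^ r / fact r"
    by (rule sum_prod_subsets_le) (use fin in auto)
  also have "\<dots> \<le> (20 / 27) ^ r / fact r"
    by (intro divide_right_mono power_mono sum_P2 sum_nonneg) auto
  finally show ?thesis .
qed

text \<open>Scaled by \<open>T / 2 ^ r\<close>, the lower bound for the size of an up-set in
  \<open>Pow P2\<close> with a member of size \<open>r\<close>; this scaling turns
  \<open>20 / 27\<close> into \<open>40 / 27\<close>.\<close>

lemma E_le:
  "E C r \<le> T / 2 ^ r * ((40 / 27) ^ r / fact r + 2 ^ r * real (m choose r) * real M / real N)"
proof -
  let ?F = "{D. D \<subseteq> P2 \<and> card D = r}"
  have "card ?F = card P2 choose r" using fin(2) by (rule n_subsets)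
  also have "\<dots> \<le> m choose r" using card by (intro binomial_right_mono) simp
  finally have cF: "real (card ?F) \<le> real (m choose r)" by simp
  have "E C r \<le> (\<Sum>D\<in>?F. (real N * (1 / real (\<Prod>D)) + real M) / 2 ^ card P1)"
    by (rule order_trans[OF E_le_sum], rule sum_mono) (use sum_w_multiples in simp)
  also have "\<dots> = (real N * (\<Sum>D\<in>?F. 1 / real (\<Prod>D)) + real (card ?F) * real M) / 2 ^ card P1"
    by (simp add: sum_divide_distrib[symmetric] sum.distrib sum_distrib_left)
  also have "\<dots> \<le> (real N * ((20 / 27) ^ r / fact r) + real (m choose r) * real M) / 2 ^ card P1"
    using cF by (intro divide_right_mono add_mono mult_left_mono mult_right_mono sum_inverse_prod_le) auto
  also have "\<dots> = T / 2 ^ r * ((40 / 27) ^ r / fact r + 2 ^ r * real (m choose r) * real M / real N)"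
  proof -
    have "(40 / 27 :: real) ^ r = 2 ^ r * (20 / 27) ^ r" by (simp flip: power_mult_distrib)
    then show ?thesis unfolding T_N using T_pos by (simp add: field_simps)
  qed
  finally show ?thesis .
qed

lemma E_le':
  "E C r \<le> T / 2 ^ r * (2 * 2 ^ card P1 * (40 / 27) ^ r / fact r)"
proof -
  let ?F = "{D. D \<subseteq> P2 \<and> card D = r}"
  have "E C r \<le> (\<Sum>D\<in>?F. 2 * real N * (1 / real (\<Prod>D)))"
    by (rule order_trans[OF E_le_sum], rule sum_mono) (use sum_w_multiples' in simp)
  also have "\<dots> = 2 * real N * (\<Sum>D\<in>?F. 1 / real (\<Prod>D))" by (simp add: sum_distrib_left)
  also have "\<dots> \<le> 2 * real N * ((20 / 27) ^ r / fact r)"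
    by (intro mult_left_mono sum_inverse_prod_le) auto
  also have "\<dots> = T / 2 ^ r * (2 * 2 ^ card P1 * (40 / 27) ^ r / fact r)"
  proof -
    have "(40 / 27 :: real) ^ r = 2 ^ r * (20 / 27) ^ r" by (simp flip: power_mult_distrib)
    then show ?thesis unfolding T_N by (simp add: field_simps)
  qed
  finally show ?thesis .
qed

lemma M_N: "120 * real m * real M \<le> real N" "16 * 4 ^ card P1 * real M \<le> real N"
  using of_nat_mono[OF err1, where ?'a = real] of_nat_mono[OF gain, where ?'a = real]
  unfolding M_def N_def by simp_all

lemma N_pos: "real N > 0" by (simp add: N_def)

text \<open>\<open>3/2\<close> is the factor that \<open>card_two_supersets\<close> gives back. The
  gap \<open>3/2 - 40/27 = 1/54\<close> leaves room for the error \<open>2/120\<close> allowed by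
  \<open>err1\<close>.\<close>

lemma E1_le: "E C 1 \<le> T / 2 * (3 / 2)"
proof -
  have "2 * real m * real M / real N \<le> 1 / 60" using M_N(1) N_pos by (simp add: field_simps)
  then have "T / 2 * (40 / 27 + 2 * real m * real M / real N) \<le> T / 2 * (3 / 2)"
    using T_pos by (intro mult_left_mono) auto
  then show ?thesis using E_le[of C 1] by simp
qed

lemma err_real: "1 \<le> r \<Longrightarrow> r \<le> r0 \<Longrightarrow> 2 ^ r * real (m choose r) * real M / real N \<le> 2 / 5"
  using of_nat_mono[OF err, where ?'a = real, of r] N_pos
  unfolding M_def N_def by (simp add: field_simps)

lemma E2_le: "E C 2 \<le> T / 4 * (3 / 2)"
proof -
  have "2 ^ 2 * real (m choose 2) * real M / real N \<le> 2 / 5" using err_real[of 2] r0 by simp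
  then have "T / 2 ^ 2 * ((40 / 27) ^ 2 / fact 2 + 2 ^ 2 * real (m choose 2) * real M / real N) \<le>
      T / 2 ^ 2 * (3 / 2)"
    using T_pos by (intro mult_left_mono) (auto simp: power2_eq_square)
  then show ?thesis using E_le[of C 2] by simp
qed

text \<open>\<open>(40 / 27) ^ 3 / 6\<close> is below \<open>3/5\<close> and \<open>err\<close>
  allows \<open>2/5\<close>, together 1: the weight does not exceed the guaranteed size of the
  up-set. Beyond \<open>r0\<close> the same follows from \<open>E_le'\<close> and
  \<open>tail\<close>.\<close>

lemma E_ge3_le:
  assumes "3 \<le> r"
  shows "E C r \<le> T / 2 ^ r"
proof (cases "r \<le> r0")
  case True
  have "(40 / 27 :: real) ^ r / fact r \<le> (40 / 27) ^ 3 / fact 3"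
    using assms by (intro power_div_fact_antimono) auto
  also have "\<dots> \<le> 3 / 5" by (simp add: fact_numeral power3_eq_cube)
  finally have "(40 / 27) ^ r / fact r + 2 ^ r * real (m choose r) * real M / real N \<le> 1"
    using err_real[of r] assms True by linarith
  then have "T / 2 ^ r * ((40 / 27) ^ r / fact r + 2 ^ r * real (m choose r) * real M / real N) \<le>
      T / 2 ^ r * 1"
    using T_pos by (intro mult_left_mono) auto
  then show ?thesis using E_le[of C r] by simp
next
  case False
  then have "T / 2 ^ r * (2 * 2 ^ card P1 * (40 / 27) ^ r / fact r) \<le> T / 2 ^ r * 1"
    using tail[of r] T_pos by (intro mult_left_mono) (auto simp: divide_simps mult.commute)
  then show ?thesis using E_le'[of C r] by simp
qed

section \<open>From weight bounds to the counting condition for up-sets\<close>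

lemma up_set_supersets:
  assumes "V \<subseteq> Pow P2" "\<And>A B. A \<in> V \<Longrightarrow> A \<subseteq> B \<Longrightarrow> B \<subseteq> P2 \<Longrightarrow> B \<in> V" "A \<in> V"
  shows "T / 2 ^ card A \<le> real (card V)"
proof -
  have "real (card {B. A \<subseteq> B \<and> B \<subseteq> P2}) \<le> real (card V)"
    using assms fin finite_subset[OF assms(1)] by (intro of_nat_mono card_mono) auto
  then show ?thesis using card_supersets[OF fin(2), of A] assms by (auto simp: T_def)
qed

text \<open>If \<open>A\<close> is a member of least size \<open>r\<close>, every index on the left
  has at least \<open>r\<close> large primes, so \<open>E C r\<close> bounds the weight and
  \<open>T / 2 ^ r\<close> bounds the size of \<open>V\<close> from below. The factor
  \<open>3/2\<close> lost at \<open>r = 1, 2\<close> is regained from a second member of size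
  \<open>r\<close>. If \<open>A\<close> is the only one, an index with exactly \<open>r\<close>
  large primes must give a multiple of \<open>\<Prod>A\<close>, and these are few.\<close>

lemma sum_w_up_set_le:
  assumes V: "V \<subseteq> Pow P2" "\<And>A B. A \<in> V \<Longrightarrow> A \<subseteq> B \<Longrightarrow> B \<subseteq> P2 \<Longrightarrow> B \<in> V" "{} \<notin> V"
  shows "(\<Sum>i | i < N \<and> S2 i \<in> V. w C i) \<le> real (card V)"
proof (cases "V = {}")
  case False
  have finV: "finite V" using V(1) fin finite_subset by blast
  define r where "r = Min (card ` V)"
  have "r \<in> card ` V" unfolding r_def using False finV by (intro Min_in) auto
  then obtain A where A: "A \<in> V" "card A = r" by blast
  have r_min: "r \<le> card B" if "B \<in> V" for B unfolding r_def using that finV by simp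
  have AP: "A \<subseteq> P2" "finite A" "A \<noteq> {}" using A V finite_subset[OF _ fin(2)] by auto
  have "card A > 0" using AP by (simp add: card_gt_0_iff)
  then have r1: "r \<ge> 1" using A(2) by simp
  have leE: "(\<Sum>i | i < N \<and> S2 i \<in> V. w C i) \<le> E C r"
    unfolding E_def using r_min w_nonneg by (intro sum_mono2) auto
  have Tr: "T / 2 ^ r \<le> real (card V)" using up_set_supersets[OF V(1,2) A(1)] A(2) by simp
  show ?thesis
  proof (cases "r \<ge> 3")
    case True
    then show ?thesis using E_ge3_le[of r C] leE Tr by linarith
  next
    case False
    then have r12: "r = 1 \<or> r = 2" using r1 by auto
    show ?thesis
    proof (cases "\<exists>A'. A' \<in> V \<and> A' \<noteq> A \<and> card A' = r")
      case True
      then obtain A' where A': "A' \<in> V" "A' \<noteq> A" "card A' = r" by blast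
      have "3 / 2 * (2 ^ card P2 / 2 ^ r) \<le> real (card {B. (A \<subseteq> B \<or> A' \<subseteq> B) \<and> B \<subseteq> P2})"
        using card_two_supersets[OF fin(2), of A A' r] A A' V(1) by auto
      also have "\<dots> \<le> real (card V)"
        using A A' V finV by (intro of_nat_mono card_mono) auto
      finally have "3 / 2 * (T / 2 ^ r) \<le> real (card V)" by (simp add: T_def)
      then show ?thesis using r12 leE E1_le[of C] E2_le[of C] by auto
    next
      case uniq: False
      have "{i. i < N \<and> S2 i \<in> V} \<subseteq>
          {i. i < N \<and> A \<subseteq> S2 i} \<union> {i. i < N \<and> Suc r \<le> card (S2 i)}"
      proof safe
        fix i assume i: "S2 i \<in> V" "\<not> Suc r \<le> card (S2 i)"
        then have "card (S2 i) = r" using r_min[OF i(1)] by simp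
        then show "p \<in> S2 i" if "p \<in> A" for p using uniq i(1) that by auto
      qed
      then have "(\<Sum>i | i < N \<and> S2 i \<in> V. w C i) \<le>
          (\<Sum>i \<in> {i. i < N \<and> A \<subseteq> S2 i} \<union> {i. i < N \<and> Suc r \<le> card (S2 i)}. w C i)"
        using w_nonneg by (intro sum_mono2) auto
      also have "\<dots> \<le> (\<Sum>i | i < N \<and> A \<subseteq> S2 i. w C i) + E C (Suc r)"
        unfolding E_def using w_nonneg
        by (subst sum.union_inter[symmetric]) (auto intro: sum_nonneg)
      also have "(\<Sum>i | i < N \<and> A \<subseteq> S2 i. w C i) \<le> (real N / real (\<Prod>A) + real M) / 2 ^ card P1"
        by (rule sum_w_multiples[OF AP(1)])
      also have "\<dots> = T / real (\<Prod>A) + T * real M / real N"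
        unfolding T_N using T_pos by (simp add: field_simps)
      \<comment> \<open>\<open>E2_le\<close> gives \<open>3/8 * T\<close> at \<open>r = 1\<close>
        and \<open>E_ge3_le\<close> gives \<open>T / 8\<close> at \<open>r = 2\<close>; both are at
        most \<open>3/4\<close> of \<open>T / 2 ^ r\<close>.\<close>
      also have "E C (Suc r) \<le> T / 2 ^ r * (3 / 4)"
        using r12 E2_le[of C] E_ge3_le[of 3 C] T_pos by (auto simp: numeral_2_eq_2 numeral_3_eq_3)
      also have "T / real (\<Prod>A) \<le> T / 17 ^ r"
      proof -
        have "(\<Prod>p\<in>A. 17) \<le> (\<Prod>p\<in>A. p)" using AP P2_ge by (intro prod_mono) auto
        then have "17 ^ r \<le> \<Prod>A" using A(2) by simp
        then have "real (17 ^ r) \<le> real (\<Prod>A)" by (rule of_nat_mono)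
        then show ?thesis using T_pos by (intro divide_left_mono) (auto intro!: mult_pos_pos prod_P2_pos AP simp flip: of_nat_prod)
      qed
      also have "T * real M / real N \<le> T / 120"
      proof -
        have "card A \<le> card P2" using AP fin by (intro card_mono) auto
        then have "1 \<le> real m" using card r1 A(2) by simp
        then have "120 * 1 * real M \<le> 120 * real m * real M" by (intro mult_right_mono mult_left_mono) auto
        then have "120 * real M \<le> real N" using M_N(1) by simp
        then have "real M / real N \<le> 1 / 120" using N_pos by (simp add: field_simps)
        then have "T * (real M / real N) \<le> T * (1 / 120)" using T_pos by (intro mult_left_mono) auto
        then show ?thesis by simp
      qed
      finally have "(\<Sum>i | i < N \<and> S2 i \<in> V. w C i) \<le> T / 17 ^ r + T / 120 + T / 2 ^ r * (3 / 4)"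
        by simp
      \<comment> \<open>\<open>1/17 + 1/120 + 3/8 < 1/2\<close> and
        \<open>1/289 + 1/120 + 3/16 < 1/4\<close>.\<close>
      also have "\<dots> \<le> T / 2 ^ r" using r12 T_pos by auto
      finally show ?thesis using Tr by simp
    qed
  qed
qed simp

text \<open>The terms prime to all of \<open>P1 \<union> P2\<close> absorb the excess of an interval of length \<open>N\<close> over
  a whole number of periods.\<close>

lemma sum_w_coprime_ge:
  "real M / 2 ^ card P1 \<le> (\<Sum>i | i < N \<and> S1 i = {} \<and> S2 i = {}. w C i)"
proof -
  let ?Z = "{i. i < N \<and> S1 i = {} \<and> S2 i = {}}"
  let ?k = "(2::real) ^ card P1"
  \<comment> \<open>All weights add up to \<open>N\<close>, so the upper bounds for the nonempty
    \<open>C\<close> force a lower bound for \<open>C = {}\<close>.\<close>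
  have "real N = (\<Sum>i<N. \<Sum>C\<in>Pow P1. w C i)"
    unfolding w_def using sum_coupling_eq_1[OF fin(1)] by simp
  also have "\<dots> = (\<Sum>C\<in>Pow P1. \<Sum>i<N. w C i)" by (rule sum.swap)
  also have "\<dots> = (\<Sum>i<N. w {} i) + (\<Sum>C\<in>Pow P1 - {{}}. \<Sum>i<N. w C i)"
    using fin by (intro sum.remove) auto
  also have "(\<Sum>C\<in>Pow P1 - {{}}. \<Sum>i<N. w C i) \<le> (\<Sum>C\<in>Pow P1 - {{}}. (real N + real M) / ?k)"
    by (intro sum_mono sum_w_all)
  also have "\<dots> = (?k - 1) * ((real N + real M) / ?k)"
    using fin by (simp add: card_Pow card_Diff_singleton of_nat_diff)
  finally have all: "real N - (?k - 1) * ((real N + real M) / ?k) \<le> (\<Sum>i<N. w {} i)" by simp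
  \<comment> \<open>\<open>w {} i\<close> vanishes unless \<open>1 + c * i\<close> is free of small
    primes. Removing the indices with a large prime, of weight at most \<open>3/4 * T\<close>,
    leaves at least \<open>T / 4 - M\<close> coprime ones.\<close>
  have "(\<Sum>i<N. w {} i) = (\<Sum>i | i < N \<and> S1 i = {}. w {} i)"
    using w_eq_0[of _ "{}"] by (intro sum.mono_neutral_right) auto
  also have "\<dots> \<le> (\<Sum>i \<in> ?Z \<union> {i. i < N \<and> 1 \<le> card (S2 i)}. w {} i)"
  proof (intro sum_mono2 w_nonneg)
    show "{i. i < N \<and> S1 i = {}} \<subseteq> ?Z \<union> {i. i < N \<and> 1 \<le> card (S2 i)}"
      using fin(2) by (auto simp: S2_def Suc_le_eq card_gt_0_iff)
  qed auto
  also have "\<dots> \<le> (\<Sum>i\<in>?Z. w {} i) + E {} 1"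
    unfolding E_def using w_nonneg
    by (subst sum.union_inter[symmetric]) (auto intro: sum_nonneg)
  also have "(\<Sum>i\<in>?Z. w {} i) \<le> (\<Sum>i\<in>?Z. 1)" by (intro sum_mono w_le_1)
  also have "E {} 1 \<le> T * (3 / 4)" using E1_le[of "{}"] by simp
  finally have "(\<Sum>i<N. w {} i) \<le> real (card ?Z) + T * (3 / 4)" by simp
  with all have "real N - (?k - 1) * ((real N + real M) / ?k) - T * (3 / 4) \<le> real (card ?Z)" by linarith
  moreover have "real N - (?k - 1) * ((real N + real M) / ?k) = T - real M + real M / ?k"
    unfolding T_N by (simp add: field_simps)
  moreover have "0 \<le> real M / ?k" by simp
  ultimately have Z: "T / 4 - real M \<le> real (card ?Z)" by linarith
  \<comment> \<open>\<open>gain\<close> says \<open>16 * ?k * M \<le> T\<close>, so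
    \<open>T / 4 - M \<ge> ?k * M\<close>. Each coprime index gives every \<open>C\<close> at least
    \<open>(1/4) ^ card P1 = 1 / (?k * ?k)\<close>, in total at least \<open>M / ?k\<close>.\<close>
  have "real M \<le> ?k * real M" using mult_right_mono[of 1 ?k "real M"] by simp
  moreover have "(4::real) ^ card P1 = ?k * ?k" by (simp flip: power_mult_distrib)
  then have "16 * (?k * real M) \<le> T" using M_N(2) unfolding T_N by (simp add: mult_ac)
  ultimately have "?k * real M \<le> real (card ?Z)" using Z by linarith
  then have "real M / ?k \<le> real (card ?Z) * (1 / 4) ^ card P1"
    using \<open>4 ^ card P1 = ?k * ?k\<close> by (simp add: field_simps power_one_over)
  also have "\<dots> = (\<Sum>i\<in>?Z. (1 / 4) ^ card P1)" by simp
  also have "\<dots> \<le> (\<Sum>i\<in>?Z. w C i)"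
    unfolding w_def using odd_primes by (intro sum_mono coupling_coprime_ge) (auto simp: S1_def)
  finally show ?thesis .
qed

text \<open>The weights of an index sum to 1 over \<open>C \<subseteq> P1\<close>, and
  \<open>U\<close> is the disjoint union of the families
  \<open>{C \<union> B | B \<in> V C}\<close>, so it suffices to compare weight and section for each
  \<open>C\<close> separately.\<close>

lemma hall_condition:
  assumes U: "U \<subseteq> Pow (P1 \<union> P2)"
    "\<And>A B. A \<in> U \<Longrightarrow> A \<subseteq> B \<Longrightarrow> B \<subseteq> P1 \<union> P2 \<Longrightarrow> B \<in> U"
  shows "card {i. i < N \<and> S1 i \<union> S2 i \<in> U} \<le> card U"
proof (cases "{} \<in> U")
  case True
  then have "U = Pow (P1 \<union> P2)" using U by blast
  then have "card U = N"
    using fin disj card by (simp add: card_Pow card_Un_disjoint N_def)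
  moreover have "card {i. i < N \<and> S1 i \<union> S2 i \<in> U} \<le> card {..<N}" by (intro card_mono) auto
  ultimately show ?thesis by simp
next
  case False
  let ?X = "{i. i < N \<and> S1 i \<union> S2 i \<in> U}"
  define V where "V C = {B. B \<subseteq> P2 \<and> C \<union> B \<in> U}" for C
  have S_sub: "S1 i \<subseteq> P1" "S2 i \<subseteq> P2" for i by (auto simp: S1_def S2_def)
  have main: "(\<Sum>i\<in>?X. w C i) \<le> real (card (V C))" if C: "C \<subseteq> P1" for C
  proof (cases "{} \<in> V C")
    case True
    have "C \<union> B \<in> U" if "B \<subseteq> P2" for B
      using U(2)[of C "C \<union> B"] True C that by (auto simp: V_def)
    then have "V C = Pow P2" unfolding V_def by auto
    then have cV: "real (card (V C)) = T" using fin by (simp add: card_Pow T_def)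
    \<comment> \<open>Here the section is all of \<open>Pow P2\<close>, so \<open>T\<close> must be
      met exactly. As \<open>{} \<notin> U\<close>, the indices prime to all primes lie outside
      \<open>?X\<close>, and their weight pays for the excess
      \<open>M / 2 ^ card P1\<close>.\<close>
    have "(\<Sum>i\<in>?X. w C i) + (\<Sum>i | i < N \<and> S1 i = {} \<and> S2 i = {}. w C i) =
        (\<Sum>i \<in> ?X \<union> {i. i < N \<and> S1 i = {} \<and> S2 i = {}}. w C i)"
      using False by (intro sum.union_disjoint[symmetric]) auto
    also have "\<dots> \<le> (\<Sum>i<N. w C i)" using w_nonneg by (intro sum_mono2) auto
    also have "\<dots> \<le> T + real M / 2 ^ card P1"
      using sum_w_all[of C] unfolding T_N by (simp add: add_divide_distrib)
    finally show ?thesis using sum_w_coprime_ge[of C] cV by linarith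
  next
    case F: False
    \<comment> \<open>Only indices with \<open>S1 i \<subseteq> C\<close> carry weight for
      \<open>C\<close>, and for these upward closure puts \<open>S2 i\<close> into the
      section.\<close>
    have "(\<Sum>i\<in>?X. w C i) = (\<Sum>i | i < N \<and> S1 i \<union> S2 i \<in> U \<and> S1 i \<subseteq> C. w C i)"
      using w_eq_0 by (intro sum.mono_neutral_right) auto
    also have "\<dots> \<le> (\<Sum>i | i < N \<and> S2 i \<in> V C. w C i)"
    proof (intro sum_mono2 w_nonneg)
      show "{i. i < N \<and> S1 i \<union> S2 i \<in> U \<and> S1 i \<subseteq> C} \<subseteq> {i. i < N \<and> S2 i \<in> V C}"
      proof safe
        fix i assume i: "S1 i \<union> S2 i \<in> U" "S1 i \<subseteq> C"
        have "C \<union> S2 i \<in> U" using U(2)[OF i(1), of "C \<union> S2 i"] i(2) C S_sub[of i] by auto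
        then show "S2 i \<in> V C" using S_sub by (simp add: V_def)
      qed
    qed auto
    also have "\<dots> \<le> real (card (V C))"
    proof (rule sum_w_up_set_le)
      fix A B assume AB: "A \<in> V C" "A \<subseteq> B" "B \<subseteq> P2"
      then show "B \<in> V C" using U(2)[of "C \<union> A" "C \<union> B"] C by (auto simp: V_def)
    qed (use F in \<open>auto simp: V_def\<close>)
    finally show ?thesis .
  qed
  have "real (card ?X) = (\<Sum>i\<in>?X. \<Sum>C\<in>Pow P1. w C i)"
    unfolding w_def using sum_coupling_eq_1[OF fin(1)] by simp
  also have "\<dots> = (\<Sum>C\<in>Pow P1. \<Sum>i\<in>?X. w C i)" by (rule sum.swap)
  also have "\<dots> \<le> (\<Sum>C\<in>Pow P1. real (card (V C)))" using main by (intro sum_mono) auto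
  also have "\<dots> = real (card (Sigma (Pow P1) V))"
    using fin by (subst card_SigmaI) (auto simp: V_def)
  also have "\<dots> \<le> real (card U)"
  proof (intro of_nat_mono card_inj_on_le)
    show "inj_on (\<lambda>(C, B). C \<union> B) (Sigma (Pow P1) V)"
      using disj by (auto simp: inj_on_def V_def set_eq_iff subset_iff) blast+
    show "(\<lambda>(C, B). C \<union> B) ` Sigma (Pow P1) V \<subseteq> U" by (auto simp: V_def)
    show "finite U" using U(1) fin by (meson finite_Pow_iff finite_UnI finite_subset)
  qed
  finally show ?thesis by simp
qed

text \<open>Hall's theorem with the supersets of \<open>S1 i \<union> S2 i\<close> as candidates for
  \<open>i\<close>. For any \<open>J\<close> the candidates form an up-set that contains
  \<open>S1 i \<union> S2 i\<close> for each \<open>i \<in> J\<close>, so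
  \<open>hall_condition\<close> applies; equal cardinalities make the injection a bijection.\<close>

lemma matching:
  "\<exists>h. bij_betw h {..<2 ^ m} (Pow (P1 \<union> P2)) \<and>
    (\<forall>i<2 ^ m. \<forall>p\<in>P1 \<union> P2. p dvd 1 + c * i \<longrightarrow> p \<in> h i)"
proof -
  define F where "F i = {B. S1 i \<union> S2 i \<subseteq> B \<and> B \<subseteq> P1 \<union> P2}" for i
  have "\<exists>h. inj_on h {..<N} \<and> (\<forall>i\<in>{..<N}. h i \<in> F i)"
  proof (rule hall_marriage)
    show "finite (F i)" for i using fin by (simp add: F_def)
    fix J assume J: "J \<subseteq> {..<N}"
    have "i \<in> {i. i < N \<and> S1 i \<union> S2 i \<in> \<Union>(F ` J)}" if "i \<in> J" for i
      using that J by (auto simp: F_def S1_def S2_def intro!: bexI[of _ i])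
    then have "card J \<le> card {i. i < N \<and> S1 i \<union> S2 i \<in> \<Union>(F ` J)}" by (intro card_mono) auto
    also have "\<dots> \<le> card (\<Union>(F ` J))"
    proof (rule hall_condition)
      fix A B assume AB: "A \<in> \<Union>(F ` J)" "A \<subseteq> B" "B \<subseteq> P1 \<union> P2"
      then obtain i where i: "i \<in> J" "S1 i \<union> S2 i \<subseteq> A" by (auto simp: F_def)
      then have "S1 i \<union> S2 i \<subseteq> B" using AB(2) by (rule_tac order_trans)
      then show "B \<in> \<Union>(F ` J)" using i(1) AB(3) by (auto simp: F_def)
    qed (auto simp: F_def)
    finally show "card J \<le> card (\<Union>(F ` J))" .
  qed simp
  then obtain h where h: "inj_on h {..<N}" "\<And>i. i < N \<Longrightarrow> h i \<in> F i" by auto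
  have "h ` {..<N} = Pow (P1 \<union> P2)"
  proof (rule card_subset_eq)
    show "h ` {..<N} \<subseteq> Pow (P1 \<union> P2)" using h(2) by (auto simp: F_def)
    have "card (Pow (P1 \<union> P2)) = N"
      using fin disj card by (simp add: card_Pow card_Un_disjoint N_def)
    then show "card (h ` {..<N}) = card (Pow (P1 \<union> P2))" using card_image[OF h(1)] by simp
  qed (use fin in simp)
  then have "bij_betw h {..<N} (Pow (P1 \<union> P2))" using h(1) by (simp add: bij_betw_def)
  moreover have "p \<in> h i" if "i < N" "p \<in> P1 \<union> P2" "p dvd 1 + c * i" for i p
    using h(2)[OF that(1)] that(2,3) by (auto simp: F_def S1_def S2_def)
  ultimately show ?thesis unfolding N_def by blast
qed

end

section \<open>Reciprocal sums of primes and other numerical bounds\<close>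

text \<open>Members of \<open>A\<close> beyond \<open>z\<close> are traded for unused members of \<open>W\<close>.\<close>

lemma sum_inverse_le_sum_inverse:
  fixes A W :: "nat set"
  assumes "finite A" "finite W" "A \<inter> {..<z} \<subseteq> W" "\<And>n. n \<in> W \<Longrightarrow> 0 < n \<and> n < z"
    and "card A \<le> card W" "0 < z"
  shows "(\<Sum>p\<in>A. 1 / real p) \<le> (\<Sum>n\<in>W. 1 / real n)"
proof -
  let ?L = "A \<inter> {..<z}"
  have "(\<Sum>p\<in>A - ?L. 1 / real p) \<le> (\<Sum>p\<in>A - ?L. 1 / real z)"
    using assms(6) by (intro sum_mono divide_left_mono) auto
  also have "\<dots> \<le> (\<Sum>n\<in>W - ?L. 1 / real z)"
    using assms by (auto simp: card_Diff_subset intro!: divide_right_mono diff_le_mono)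
  also have "\<dots> \<le> (\<Sum>n\<in>W - ?L. 1 / real n)"
  proof (rule sum_mono)
    fix n assume "n \<in> W - ?L"
    then show "1 / real z \<le> 1 / real n" using assms(4)[of n] by (intro divide_left_mono) auto
  qed
  finally have "(\<Sum>p\<in>A - ?L. 1 / real p) \<le> (\<Sum>n\<in>W - ?L. 1 / real n)" .
  then show ?thesis
    using sum.subset_diff[of ?L A "\<lambda>p. 1 / real p"] sum.subset_diff[of ?L W "\<lambda>p. 1 / real p"] assms
    by simp
qed

text \<open>The residues modulo 30 that are prime to 30.\<close>

definition wheel30 :: "nat set" where
  "wheel30 = {1, 7, 11, 13, 17, 19, 23, 29}"

lemma less_30_cases: "n < 30 \<Longrightarrow> n \<in> {0, 1, 2, 3, 4, 5, 6, 7, 8, 9, 10, 11, 12, 13, 14, 15, 16, 17, 18,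
    19, 20, 21, 22, 23, 24, 25, 26, 27, 28, 29 :: nat}"
  by (auto simp: numeral_eq_Suc less_Suc_eq)

lemma prime_mod_30:
  assumes "prime (p::nat)" "5 < p"
  shows "p mod 30 \<in> wheel30"
proof -
  have nd: "\<not> q dvd p" if "q \<in> {2, 3, 5}" for q
    using assms that primes_dvd_imp_eq[of q p] by auto
  have "\<not> q dvd p mod 30" if "q \<in> {2, 3, 5}" for q
    using nd[OF that] that by (auto simp: dvd_mod_iff)
  then have "\<not> 2 dvd p mod 30" "\<not> 3 dvd p mod 30" "\<not> 5 dvd p mod 30" by auto
  moreover have "p mod 30 < 30" by simp
  note less_30_cases[OF this]
  ultimately show ?thesis
    by (elim insertE emptyE) (simp_all add: wheel30_def)
qed

text \<open>\<open>ln x\<close> is twice the area hyperbolic tangent series in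
  \<open>(x - 1) / (x + 1)\<close>, here \<open>1 / (2 * j + 1)\<close>; two terms are kept.\<close>

lemma ln_Suc_diff_ge:
  assumes "j > 0"
  shows "2 / (2 * real j + 1) + 2 / (3 * (2 * real j + 1) ^ 3) \<le> ln (real j + 1) - ln (real j)"
proof -
  define x where "x = (real j + 1) / real j"
  have x: "x > 1" using assms by (simp add: x_def)
  define u where "u = 1 / (2 * real j + 1)"
  have y: "(x - 1) / (x + 1) = u"
    using assms by (simp add: x_def u_def divide_simps)
  have "2 * u + 2 / 3 * u ^ 3 \<le> ln x"
    using ln_approx_bounds[OF x, of 2, unfolded y] by (simp add: lessThan_nat_numeral lessThan_Suc power2_eq_square power3_eq_cube)
  then have "2 / (2 * real j + 1) + 2 / (3 * (2 * real j + 1) ^ 3) \<le> ln x"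
    by (simp add: u_def power_one_over)
  also have "ln x = ln (real j + 1) - ln (real j)"
    using assms by (simp add: x_def ln_div)
  finally show ?thesis .
qed

text \<open>Eight residues per block of 30 have density \<open>8/30 = 4/15\<close>. By convexity the
  sum exceeds its midpoint value \<open>8 / v\<close>, so the third-order term of the logarithm
  matters: the excess is about \<open>560 / v ^ 3\<close>, with
  \<open>560 = 2 * (14 ^ 2 + 8 ^ 2 + 4 ^ 2 + 2 ^ 2)\<close>, against \<open>600 / v ^ 3\<close>
  available.\<close>

lemma sum_wheel30_le:
  assumes "j \<ge> 2"
  shows "(\<Sum>r\<in>wheel30. 1 / real (30 * j + r)) \<le> 4 / 15 * (ln (real j + 1) - ln (real j))"
proof -
  \<comment> \<open>The residues come in pairs symmetric about the midpoint \<open>v\<close> of the block.\<close>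
  define v where "v = 30 * real j + 15"
  have v: "v \<ge> 75" using assms by (simp add: v_def)
  have v2: "v\<^sup>2 \<ge> 75\<^sup>2" using v by (intro power_mono) auto
  have pair: "1 / (v - e) + 1 / (v + e) \<le> 2 / v + 2 * e\<^sup>2 / (v * (v\<^sup>2 - 196))"
    if "0 \<le> e" "e \<le> 14" for e
  proof -
    have "e\<^sup>2 \<le> 14\<^sup>2" using that by (intro power_mono) auto
    then have pos: "0 < v\<^sup>2 - 196" "v\<^sup>2 - 196 \<le> v\<^sup>2 - e\<^sup>2" using v2 by auto
    have "1 / (v - e) + 1 / (v + e) = 2 / v + 2 * e\<^sup>2 / (v * (v\<^sup>2 - e\<^sup>2))"
    proof -
      have "v - e \<noteq> 0" "v + e \<noteq> 0" "v \<noteq> 0" using v that by auto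
      moreover have "v\<^sup>2 - e\<^sup>2 = (v - e) * (v + e)" by (simp add: power2_eq_square algebra_simps)
      ultimately show ?thesis by (simp add: divide_simps) (simp add: power2_eq_square algebra_simps)
    qed
    also have "\<dots> \<le> 2 / v + 2 * e\<^sup>2 / (v * (v\<^sup>2 - 196))"
      using pos v by (intro add_left_mono divide_left_mono mult_left_mono mult_pos_pos) auto
    finally show ?thesis .
  qed
  have "(\<Sum>r\<in>wheel30. 1 / real (30 * j + r)) =
      (1 / (v - 14) + 1 / (v + 14)) + (1 / (v - 8) + 1 / (v + 8)) +
      (1 / (v - 4) + 1 / (v + 4)) + (1 / (v - 2) + 1 / (v + 2))"
    by (simp add: wheel30_def v_def add.commute)
  also have "\<dots> \<le> 8 / v + 560 / (v * (v\<^sup>2 - 196))"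
    using pair[of 14] pair[of 8] pair[of 4] pair[of 2] by (simp add: add_divide_distrib[symmetric])
  \<comment> \<open>This amounts to \<open>v * v \<ge> 2940\<close>: true for \<open>v = 75\<close>,
    the block \<open>j = 2\<close>, but false for \<open>v = 45\<close>, the block
    \<open>j = 1\<close>.\<close>
  also have "560 / (v * (v\<^sup>2 - 196)) \<le> 600 / v ^ 3"
    using v v2 by (simp add: divide_simps power2_eq_square power3_eq_cube algebra_simps)
  also have "8 / v + 600 / v ^ 3 = 4 / 15 * (2 / (2 * real j + 1) + 2 / (3 * (2 * real j + 1) ^ 3))"
  proof -
    define t where "t = 2 * real j + 1"
    have "v = 15 * t" "t > 0" by (simp_all add: v_def t_def)
    then show ?thesis unfolding t_def[symmetric] by (simp add: field_simps power3_eq_cube)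
  qed
  also have "\<dots> \<le> 4 / 15 * (ln (real j + 1) - ln (real j))"
    using ln_Suc_diff_ge[of j] assms by (intro mult_left_mono) auto
  finally show ?thesis by simp
qed

lemma inj_on_div_mod_30: "inj_on (\<lambda>(j, r). 30 * j + r) (A \<times> wheel30)"
proof (rule inj_onI, clarify)
  fix j r j' r' assume *: "r \<in> wheel30" "r' \<in> wheel30" "30 * j + r = 30 * j' + (r'::nat)"
  then have "r < 30" "r' < 30" by (auto simp: wheel30_def)
  then have "(30 * j + r) div 30 = j" "(30 * j' + r') div 30 = j'" by auto
  then show "j = j' \<and> r = r'" using *(3) by simp
qed

lemma sum_inverse_primes_le:
  assumes "finite A" "finite L" "\<And>p. p \<in> A \<Longrightarrow> prime p" "\<And>p. p \<in> A \<Longrightarrow> p < 30 * b \<Longrightarrow> p \<in> L"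
    and "\<And>n. n \<in> L \<Longrightarrow> 0 < n \<and> n < 30 * b" "2 \<le> b" "b \<le> d"
    and "card A \<le> card L + 8 * (d - b)"
  shows "(\<Sum>p\<in>A. 1 / real p) \<le> (\<Sum>n\<in>L. 1 / real n) + 4 / 15 * (ln (real d) - ln (real b))"
proof -
  let ?f = "\<lambda>(j, r). 30 * j + r :: nat"
  define W where "W = ?f ` ({b..<d} \<times> wheel30)"
  have "card wheel30 = 8" by (simp add: wheel30_def)
  then have cW: "card W = 8 * (d - b)" unfolding W_def
    by (subst card_image[OF inj_on_div_mod_30]) (simp add: card_cartesian_product)
  have finW: "finite W" unfolding W_def by (simp add: wheel30_def)
  have W_bounds: "30 * b < n \<and> n < 30 * d" if "n \<in> W" for n
    using that unfolding W_def wheel30_def by auto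
  then have LW: "L \<inter> W = {}" using assms(5) by fastforce
  have "(\<Sum>p\<in>A. 1 / real p) \<le> (\<Sum>n\<in>L \<union> W. 1 / real n)"
  proof (rule sum_inverse_le_sum_inverse[OF assms(1)])
    show "A \<inter> {..<30 * d} \<subseteq> L \<union> W"
    proof
      fix p assume p: "p \<in> A \<inter> {..<30 * d}"
      show "p \<in> L \<union> W"
      proof (cases "p < 30 * b")
        case False
        have "p mod 30 \<in> wheel30" using p False assms(3,6) by (intro prime_mod_30) auto
        moreover have "p div 30 \<in> {b..<d}" using p False by auto
        ultimately have "p \<in> W" unfolding W_def
          by (intro image_eqI[of _ _ "(p div 30, p mod 30)"]) auto
        then show ?thesis by simp
      qed (use p assms(4) in auto)
    qed
    show "card A \<le> card (L \<union> W)" using assms(2,8) LW finW cW by (simp add: card_Un_disjoint)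
    show "0 < n \<and> n < 30 * d" if "n \<in> L \<union> W" for n
      using that assms(5,7) W_bounds by fastforce
  qed (use assms finW in auto)
  also have "\<dots> = (\<Sum>n\<in>L. 1 / real n) + (\<Sum>n\<in>W. 1 / real n)"
    using assms(2) finW LW by (rule sum.union_disjoint)
  also have "(\<Sum>n\<in>W. 1 / real n) = (\<Sum>j=b..<d. \<Sum>r\<in>wheel30. 1 / real (30 * j + r))"
    unfolding W_def by (subst sum.reindex[OF inj_on_div_mod_30])
      (simp add: sum.cartesian_product case_prod_unfold)
  also have "\<dots> \<le> (\<Sum>j=b..<d. 4 / 15 * (ln (real (Suc j)) - ln (real j)))"
  proof (rule sum_mono)
    fix j assume "j \<in> {b..<d}"
    then show "(\<Sum>r\<in>wheel30. 1 / real (30 * j + r)) \<le> 4 / 15 * (ln (real (Suc j)) - ln (real j))"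
      using sum_wheel30_le[of j] assms(6) by (simp add: add.commute)
  qed
  also have "\<dots> = 4 / 15 * (ln (real d) - ln (real b))"
    unfolding sum_distrib_left[symmetric] using sum_Suc_diff'[OF assms(7), of "\<lambda>j. ln (real j)"] by simp
  finally show ?thesis by simp
qed

section \<open>Primes below 210 and the product of all primes up to a bound\<close>

definition small_primes :: "nat list" where
  "small_primes = [2, 3, 5, 7, 11, 13, 17, 19, 23, 29, 31, 37, 41, 43, 47, 53, 59, 61, 67, 71, 73,
    79, 83, 89, 97, 101, 103, 107, 109, 113, 127, 131, 137, 139, 149, 151, 157, 163, 167, 173,
    179, 181, 191, 193, 197, 199]"

text \<open>As \<open>17 * 17 > 210\<close>, sieving by the primes up to 13 suffices: 2, 3 and 5
  through \<open>prime_mod_30\<close>, then 7, 11 and 13 within the seven blocks of 30.\<close>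

lemma prime_in_small_primes:
  assumes "prime p" "p < 210"
  shows "p \<in> set small_primes"
proof (cases "p \<le> 13")
  case True
  have nd: "\<not> q dvd p" if "q \<in> {2, 3}" "q \<noteq> p" for q
    using assms that primes_dvd_imp_eq[of q p] by auto
  have "p < 30" using True by simp
  from less_30_cases[OF this] show ?thesis using nd[of 2] nd[of 3] prime_ge_2_nat[OF assms(1)] True
    by (elim insertE emptyE) (simp_all add: small_primes_def)
next
  case False
  have nd: "\<not> 7 dvd p" "\<not> 11 dvd p" "\<not> 13 dvd p"
    using assms False primes_dvd_imp_eq[of 7 p] primes_dvd_imp_eq[of 11 p] primes_dvd_imp_eq[of 13 p]
    by auto
  define j r where "j = p div 30" and "r = p mod 30"
  have p: "p = 30 * j + r" by (simp add: j_def r_def)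
  have r: "r \<in> wheel30" unfolding r_def using assms(1) False by (intro prime_mod_30) auto
  have "j < 7" using assms(2) by (simp add: j_def)
  then have "j \<in> {0, 1, 2, 3, 4, 5, 6}" by auto
  then show ?thesis using nd r False unfolding p wheel30_def small_primes_def
    by (elim insertE emptyE) simp_all
qed

text \<open>The row \<open>2 * k + 1\<close> has sum \<open>2 * 4 ^ k\<close> and two equal middle
  entries.\<close>

lemma choose_Suc_double_le: "(2 * k + 1) choose k \<le> 4 ^ k"
proof -
  have "2 * ((2 * k + 1) choose k) = (\<Sum>i\<in>{k, k + 1}. (2 * k + 1) choose i)"
    using binomial_symmetric[of k "2 * k + 1"] by simp
  also have "\<dots> \<le> (\<Sum>i\<le>2 * k + 1. (2 * k + 1) choose i)" by (intro sum_mono2) auto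
  also have "\<dots> = 2 * 4 ^ k" unfolding choose_row_sum by (simp add: power_mult)
  finally show ?thesis by simp
qed

text \<open>Erdos's argument: the primes from \<open>k + 2\<close> to \<open>2 * k + 1\<close> all
  divide \<open>(2 * k + 1) choose k\<close>, which is at most \<open>4 ^ k\<close>; even
  \<open>n > 2\<close> reduces to \<open>n - 1\<close>.\<close>

lemma primorial_le: "\<Prod>{p. prime p \<and> p \<le> n} \<le> 4 ^ n"
proof (induction n rule: less_induct)
  case (less n)
  let ?P = "\<lambda>n. {p::nat. prime p \<and> p \<le> n}"
  have fin: "finite (?P n)" for n by (rule finite_subset[of _ "{..n}"]) auto
  consider "n = 0" | "n = 1" | "n = 2" | "n > 2" "even n" | k where "n = 2 * k + 1" "k \<ge> 1"
  proof -
    have "n \<le> 2 \<Longrightarrow> n = 0 \<or> n = 1 \<or> n = 2" by auto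
    moreover have "\<exists>k\<ge>1. n = 2 * k + 1" if "odd n" "n > 2" using that by (auto elim!: oddE)
    ultimately show ?thesis using that by (meson not_le)
  qed
  then show ?case
  proof cases
    case 1
    then have "?P n = {}" by auto
    then show ?thesis by (simp only:) simp
  next
    case 2
    then have "?P n = {}" by (auto dest: prime_ge_2_nat)
    then show ?thesis by (simp only:) simp
  next
    case 3
    have "?P 2 = {2}" by (auto dest: prime_ge_2_nat)
    then show ?thesis using 3 by simp
  next
    case 4
    have "\<not> prime n" using 4 prime_odd_nat by blast
    then have "?P n = ?P (n - 1)" using 4 by (auto simp: le_less dest!: less_imp_Suc_add)
    then have "\<Prod>(?P n) \<le> 4 ^ (n - 1)" using less[of "n - 1"] 4 by simp
    also have "\<dots> \<le> 4 ^ n" by (intro power_increasing) auto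
    finally show ?thesis .
  next
    case 5
    let ?Q = "{p. prime p \<and> k + 1 < p \<and> p \<le> n}"
    have "\<Prod>?Q dvd n choose k"
    proof (subst prod_primes_dvd_iff)
      show "\<forall>p\<in>?Q. p dvd n choose k"
      proof safe
        fix p assume p: "prime p" "k + 1 < p" "p \<le> n"
        have "fact k * fact (n - k) * (n choose k) = fact n" using 5 by (intro binomial_fact_lemma) auto
        moreover have "p dvd fact n" using p by (simp add: prime_dvd_fact_iff)
        moreover have "\<not> p dvd fact k" "\<not> p dvd fact (n - k)" using p 5
          by (auto simp: prime_dvd_fact_iff simp del: fact_Suc)
        ultimately show "p dvd n choose k" using p(1) by (metis prime_dvd_mult_iff)
      qed
    qed (use finite_subset[OF _ fin[of n]] in auto)
    then have "\<Prod>?Q \<le> n choose k" using 5 by (intro dvd_imp_le) auto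
    also have "\<dots> \<le> 4 ^ k" using choose_Suc_double_le 5 by simp
    finally have Q: "\<Prod>?Q \<le> 4 ^ k" .
    have "?P n = ?P (k + 1) \<union> ?Q" using 5 by auto
    then have "\<Prod>(?P n) = \<Prod>(?P (k + 1)) * \<Prod>?Q"
      using finite_subset[OF _ fin[of n], of ?Q] fin by (simp only:) (intro prod.union_disjoint; auto)
    also have "\<dots> \<le> 4 ^ (k + 1) * 4 ^ k" using less[of "k + 1"] 5 Q by (intro mult_mono) auto
    also have "\<dots> = 4 ^ n" using 5 by (simp flip: power_add)
    finally show ?thesis .
  qed
qed

section \<open>Binomial coefficients against powers\<close>

lemma choose_le_double: "2 * r \<le> Suc m \<Longrightarrow> Suc m choose r \<le> 2 * (m choose r)"
proof -
  assume r: "2 * r \<le> Suc m"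
  have "(Suc m - r) * (Suc m choose r) = Suc m * (m choose r)"
    using binomial_absorb_comp[of "Suc m" r] by simp
  also have "\<dots> \<le> (2 * (Suc m - r)) * (m choose r)" using r by (intro mult_right_mono) auto
  finally have "(Suc m - r) * (Suc m choose r) \<le> (Suc m - r) * (2 * (m choose r))" by (simp add: mult_ac)
  then show ?thesis using r by (cases "Suc m - r = 0") (auto simp del: binomial_Suc_Suc)
qed

text \<open>\<open>(m choose r) / 2 ^ m\<close> does not increase once \<open>2 * r \<le> m\<close>,
  so the error bounds can be checked at the lower end \<open>lo\<close> of a range of
  \<open>m\<close>.\<close>

lemma choose_power_antimono:
  assumes "lo \<le> m" "2 * r \<le> lo"
  shows "(m choose r) * 2 ^ lo \<le> (lo choose r) * 2 ^ m"
  using assms(1)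
proof (induction m rule: dec_induct)
  case (step m)
  have "(Suc m choose r) * 2 ^ lo \<le> 2 * (m choose r) * 2 ^ lo"
    using choose_le_double[of r m] step assms by (intro mult_right_mono) auto
  also have "\<dots> \<le> (lo choose r) * 2 ^ Suc m" using step by simp
  finally show ?case .
qed simp


text \<open>\<open>(2 * lo) ^ r / fact r\<close> does not decrease up to \<open>r = 2 * lo\<close>,
  so its value at \<open>r0\<close> controls all smaller \<open>r\<close>.\<close>

lemma power_mult_choose_le: "r \<le> r0 \<Longrightarrow> r0 \<le> 2 * lo \<Longrightarrow>
  2 ^ r * real (lo choose r) \<le> (2 * real lo) ^ r0 / fact r0"
proof -
  assume r: "r \<le> r0" "r0 \<le> 2 * lo"
  have "(lo choose r) * fact r \<le> lo ^ r" by (rule binomial_fact_pow)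
  then have "real (lo choose r) * fact r \<le> real lo ^ r"
    by (metis of_nat_fact of_nat_le_iff of_nat_mult of_nat_power)
  then have "2 ^ r * real (lo choose r) \<le> (2 * real lo) ^ r / fact r"
    by (simp add: power_mult_distrib pos_le_divide_eq mult_ac)
  also have "\<dots> \<le> (2 * real lo) ^ r0 / fact r0"
    using r(1) r(2)
  proof (induction r0 rule: dec_induct)
    case (step k)
    have "(2 * real lo) ^ k / fact k \<le> (2 * real lo) / real (Suc k) * ((2 * real lo) ^ k / fact k)"
    proof -
      have "1 \<le> (2 * real lo) / real (Suc k)" using step.prems by (simp add: divide_simps)
      then have "1 * ((2 * real lo) ^ k / fact k) \<le> 2 * real lo / real (Suc k) * ((2 * real lo) ^ k / fact k)"
        by (rule mult_right_mono) simp
      then show ?thesis by (simp only: mult_1)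
    qed
    also have "\<dots> = (2 * real lo) ^ Suc k / fact (Suc k)" by (simp add: divide_simps)
    finally show ?case using step by simp
  qed simp
  finally show ?thesis .
qed

text \<open>\<open>y\<close> separates small from large primes, \<open>k\<close> and
  \<open>K\<close> bound the number and the product of the small ones, and \<open>lo\<close> is the
  lower end of a range of \<open>m\<close>. The numerical hypotheses are those of
  \<open>sieve_data\<close>, reduced to \<open>lo\<close> and, for the tail, to
  \<open>r0 + 1\<close>.\<close>

lemma matching_of_bounds:
  assumes c: "0 < c" "c \<le> 2"
    and P: "finite P" "\<And>p. p \<in> P \<Longrightarrow> prime p \<and> p \<ge> 3" "card P = m" "lo \<le> m"
    and y: "13 \<le> y" "card {p \<in> P. p \<le> y} \<le> k" "\<Prod>{p \<in> P. p \<le> y} \<le> K"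
    and sum: "(\<Sum>p | p \<in> P \<and> y < p. 1 / real p) \<le> 20 / 27"
    and r0: "3 \<le> r0" "2 * r0 \<le> lo"
    and err: "\<And>r. 1 \<le> r \<Longrightarrow> r \<le> r0 \<Longrightarrow> 5 * (2 ^ r * (lo choose r) * K) \<le> 2 * 2 ^ lo"
    and err1: "120 * lo * K \<le> 2 ^ lo"
    and tail: "2 * 2 ^ k * (40 / 27) ^ Suc r0 \<le> (fact (Suc r0) :: real)"
    and gain: "16 * 4 ^ k * K \<le> 2 ^ lo"
  shows "\<exists>h. bij_betw h {..<2 ^ m} (Pow P) \<and> (\<forall>i<2 ^ m. \<forall>p\<in>P. p dvd 1 + c * i \<longrightarrow> p \<in> h i)"
proof -
  let ?P1 = "{p \<in> P. p \<le> y}" and ?P2 = "{p \<in> P. y < p}"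
  have P12: "P = ?P1 \<union> ?P2" by auto
  have scale: "2 * r \<le> lo \<Longrightarrow> C * ((lo choose r) * K) \<le> B * 2 ^ lo \<Longrightarrow>
      C * ((m choose r) * \<Prod>?P1) \<le> B * 2 ^ m" for r B C
  proof -
    assume r: "2 * r \<le> lo" "C * ((lo choose r) * K) \<le> B * 2 ^ lo"
    have "C * ((m choose r) * \<Prod>?P1) * 2 ^ lo \<le> C * ((m choose r) * 2 ^ lo * K)"
      using y(3) by (simp add: mult_ac mult_le_mono)
    also have "\<dots> \<le> C * ((lo choose r) * 2 ^ m * K)"
      by (rule mult_le_mono2[OF mult_le_mono1[OF choose_power_antimono[OF P(4) r(1)]]])
    also have "\<dots> = (C * ((lo choose r) * K)) * 2 ^ m" by (simp add: mult_ac)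
    also have "\<dots> \<le> (B * 2 ^ lo) * 2 ^ m" using r(2) by (rule mult_le_mono1)
    finally show ?thesis by (simp add: mult_ac)
  qed
  have "sieve_data c m r0 ?P1 ?P2"
  proof
    show "card ?P1 + card ?P2 = m"
    proof -
      have "card (?P1 \<union> ?P2) = card ?P1 + card ?P2"
        using P(1) by (intro card_Un_disjoint) auto
      then show ?thesis using P12 P(3) by simp
    qed
    show "p \<ge> 17" if "p \<in> ?P2" for p
    proof (rule ccontr)
      assume "\<not> p \<ge> 17"
      then have "p = 14 \<or> p = 15 \<or> p = 16" using that y(1) by auto
      moreover have "prime p" using that P(2) by auto
      ultimately show False using primes_dvd_imp_eq[of 2 p] primes_dvd_imp_eq[of 3 p] by auto
    qed
    show "5 * (2 ^ r * (m choose r) * \<Prod>?P1) \<le> 2 * 2 ^ m" if "1 \<le> r" "r \<le> r0" for r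
      using scale[of r "5 * 2 ^ r" 2] err[OF that] that r0 by (simp add: mult_ac)
    show "120 * m * \<Prod>?P1 \<le> 2 ^ m" using scale[of 1 120 1] err1 r0 by (simp add: mult_ac)
    show "16 * 4 ^ card ?P1 * \<Prod>?P1 \<le> 2 ^ m"
    proof -
      have "16 * 4 ^ card ?P1 * \<Prod>?P1 \<le> 16 * 4 ^ k * \<Prod>?P1"
        using y(2) by (intro mult_le_mono power_increasing) auto
      also have "\<dots> \<le> 2 ^ m" using scale[of 0 "16 * 4 ^ k" 1] gain by (simp add: mult_ac)
      finally show ?thesis .
    qed
    show "2 * 2 ^ card ?P1 * (40 / 27) ^ r \<le> (fact r :: real)" if "r0 < r" for r
    proof -
      have "(40 / 27 :: real) ^ r / fact r \<le> (40 / 27) ^ Suc r0 / fact (Suc r0)"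
        using that r0 by (intro power_div_fact_antimono) auto
      then have "2 * 2 ^ k * ((40 / 27 :: real) ^ r / fact r) \<le> 2 * 2 ^ k * ((40 / 27) ^ Suc r0 / fact (Suc r0))"
        by (intro mult_left_mono) auto
      also have "\<dots> \<le> 1" using tail by (simp del: fact_Suc power_Suc)
      finally have "2 * 2 ^ k * (40 / 27 :: real) ^ r \<le> fact r" by (simp add: divide_simps mult.commute)
      moreover have "2 * 2 ^ card ?P1 * (40 / 27 :: real) ^ r \<le> 2 * 2 ^ k * (40 / 27) ^ r"
        using y(2) by (intro mult_right_mono mult_left_mono power_increasing) auto
      ultimately show ?thesis by linarith
    qed
  qed (use c P sum r0 in auto)
  from sieve_data.matching[OF this] show ?thesis by (simp only: P12[symmetric])
qed

section \<open>Choice of the parameters for the successive ranges of \<open>m\<close>\<close>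

lemma prod_le_prod_subset:
  fixes B :: "nat set"
  assumes "finite B" "A \<subseteq> B" "\<And>b. b \<in> B \<Longrightarrow> 0 < b"
  shows "\<Prod>A \<le> \<Prod>B"
  using assms by (intro dvd_imp_le prod_dvd_prod_subset) (auto intro!: prod_pos)

lemma distinct_small_primes: "distinct small_primes"
  by (simp add: small_primes_def)

lemma small_part_bounds:
  assumes "\<And>p. p \<in> P \<Longrightarrow> prime p \<and> p \<ge> 3" "y < 210"
  defines "L \<equiv> filter (\<lambda>p. 3 \<le> p \<and> p \<le> y) small_primes"
  shows "card {p \<in> P. p \<le> y} \<le> length L" "\<Prod>{p \<in> P. p \<le> y} \<le> prod_list L"
proof -
  have sub: "{p \<in> P. p \<le> y} \<subseteq> set L"
    unfolding L_def using assms(1,2) prime_in_small_primes by fastforce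
  have dist: "distinct L" unfolding L_def using distinct_small_primes by simp
  show "card {p \<in> P. p \<le> y} \<le> length L"
    using card_mono[OF _ sub] distinct_card[OF dist] by simp
  have "\<Prod>{p \<in> P. p \<le> y} \<le> \<Prod>(set L)"
    by (rule prod_le_prod_subset) (use sub L_def in auto)
  also have "\<dots> = prod_list L"
    using prod.distinct_set_conv_list[OF dist, of "\<lambda>x. x"] by simp
  finally show "\<Prod>{p \<in> P. p \<le> y} \<le> prod_list L" .
qed

lemma sum_large_part_le:
  fixes y b d :: nat
  assumes "finite P" "\<And>p. p \<in> P \<Longrightarrow> prime p \<and> p \<ge> 3" "2 \<le> b" "b \<le> 7" "b \<le> d"
  defines "L \<equiv> filter (\<lambda>p. y < p \<and> p < 30 * b) small_primes"
  assumes "card P \<le> length L + 8 * (d - b)"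
  shows "(\<Sum>p | p \<in> P \<and> y < p. 1 / real p) \<le>
    (\<Sum>p\<leftarrow>L. 1 / real p) + 4 / 15 * (ln (real d) - ln (real b))"
proof -
  have dist: "distinct L" unfolding L_def using distinct_small_primes by simp
  have "(\<Sum>p | p \<in> P \<and> y < p. 1 / real p) \<le>
      (\<Sum>p\<in>set L. 1 / real p) + 4 / 15 * (ln (real d) - ln (real b))"
  proof (rule sum_inverse_primes_le)
    show "p \<in> set L" if "p \<in> {p \<in> P. y < p}" "p < 30 * b" for p
      using that assms(2,4) prime_in_small_primes[of p] by (auto simp: L_def)
    have "card {p \<in> P. y < p} \<le> card P" using assms(1) by (intro card_mono) auto
    then show "card {p \<in> P. y < p} \<le> card (set L) + 8 * (d - b)"
      using assms(7) distinct_card[OF dist] by simp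
  qed (use assms in \<open>auto simp: L_def\<close>)
  then show ?thesis using sum.distinct_set_conv_list[OF dist] by metis
qed

text \<open>\<open>b = a\<close> and \<open>d = 16 * a\<close> in
  \<open>sum_inverse_primes_le\<close> give room for \<open>8 * 15 * a = 120 * a\<close> primes and
  the bound \<open>4/15 * ln 16 \<le> 16/15 * 25/36 = 20/27\<close>; this is where the constant
  comes from.\<close>

lemma sum_above_le:
  assumes "finite P" "\<And>p. p \<in> P \<Longrightarrow> prime p \<and> p \<ge> 3" "card P \<le> 120 * a" "2 \<le> a"
  shows "(\<Sum>p | p \<in> P \<and> 30 * a < p. 1 / real p) \<le> 20 / 27"
proof -
  have "card {p \<in> P. 30 * a < p} \<le> card P" using assms(1) by (intro card_mono) auto
  then have "(\<Sum>p | p \<in> P \<and> 30 * a < p. 1 / real p) \<le>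
      (\<Sum>n\<in>{}. 1 / real n) + 4 / 15 * (ln (real (16 * a)) - ln (real a))"
    by (intro sum_inverse_primes_le) (use assms in auto)
  also have "ln (real (16 * a)) - ln (real a) = ln (2 ^ 4)"
    using assms(4) by (simp add: ln_mult)
  also have "\<dots> = 4 * ln 2" by (subst ln_realpow) auto
  finally show ?thesis using ln2_le_25_over_36 by simp
qed

text \<open>The \<open>8 * a\<close> numbers below \<open>30 * a\<close> that are prime to 30 lose 1
  and gain 3 and 5.\<close>

lemma card_odd_primes_le:
  assumes "\<And>p. p \<in> P \<Longrightarrow> prime p \<and> p \<ge> 3" "1 \<le> a"
  shows "card {p \<in> P. p \<le> 30 * a} \<le> 8 * a + 1"
proof -
  define W where "W = (\<lambda>(j, r). 30 * j + r :: nat) ` ({..<a} \<times> wheel30)"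
  have w: "card wheel30 = 8" "finite wheel30" by (simp_all add: wheel30_def)
  have W: "card W = 8 * a" "finite W" unfolding W_def
    using w by (auto simp: card_image[OF inj_on_div_mod_30] card_cartesian_product)
  have "1 \<in> W" unfolding W_def using assms(2)
    by (intro image_eqI[of _ _ "(0, 1)"]) (auto simp: wheel30_def)
  have "{p \<in> P. p \<le> 30 * a} \<subseteq> insert 3 (insert 5 (W - {1}))"
  proof
    fix p assume "p \<in> {p \<in> P. p \<le> 30 * a}"
    then have p: "prime p" "3 \<le> p" "p \<le> 30 * a" using assms(1) by auto
    show "p \<in> insert 3 (insert 5 (W - {1}))"
    proof (cases "p \<le> 5")
      case True
      moreover have "\<not> prime (4::nat)" by simp
      ultimately show ?thesis using p(1,2) by (cases "p = 4") auto
    next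
      case False
      then have r: "p mod 30 \<in> wheel30" using p by (intro prime_mod_30) auto
      then have "p mod 30 \<noteq> 0" by (auto simp: wheel30_def)
      then have "p \<noteq> 30 * a" by auto
      then have "p div 30 < a" using p(3) by auto
      then have "p \<in> W" unfolding W_def using r
        by (intro image_eqI[of _ _ "(p div 30, p mod 30)"]) auto
      then show ?thesis using False by auto
    qed
  qed
  then have "card {p \<in> P. p \<le> 30 * a} \<le> card (insert 3 (insert 5 (W - {1})))"
    using W(2) by (intro card_mono) auto
  also have "\<dots> \<le> Suc (Suc (card (W - {1})))"
    using W(2) by (simp add: card_insert_if)
  also have "\<dots> = 8 * a + 1" using W \<open>1 \<in> W\<close> assms(2) by (simp add: card_Diff_singleton)
  finally show ?thesis .
qed

lemma choose_error_le:
  fixes lo K :: nat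
  assumes "r \<le> r0" "r0 \<le> 2 * lo" "5 * K * (2 * lo) ^ r0 \<le> 2 * 2 ^ lo * fact r0"
  shows "5 * (2 ^ r * (lo choose r) * K) \<le> 2 * 2 ^ lo"
proof -
  have "5 * real K * (2 ^ r * real (lo choose r)) \<le> 5 * real K * ((2 * real lo) ^ r0 / fact r0)"
    using power_mult_choose_le[OF assms(1,2)] by (intro mult_left_mono) auto
  also have "\<dots> \<le> 2 * 2 ^ lo"
  proof -
    have "real (5 * K * (2 * lo) ^ r0) \<le> real (2 * 2 ^ lo * fact r0)"
      using assms(3) by (rule of_nat_mono)
    then show ?thesis by (simp add: pos_divide_le_eq)
  qed
  finally have "real (5 * (2 ^ r * (lo choose r) * K)) \<le> real (2 * 2 ^ lo)" by (simp add: mult_ac)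
  then show ?thesis by (simp only: of_nat_le_iff)
qed

text \<open>The cut-off \<open>y\<close> between small and large primes grows with \<open>m\<close>: it must be large enough for
  \<open>\<sigma> \<le> 20 / 27\<close> and small enough for the period \<open>\<Prod>P1\<close> to be negligible against \<open>2 ^ m\<close>.\<close>

lemma matching_44_72:
  fixes c m :: nat and P :: "nat set"
  assumes "0 < c" "c \<le> 2" "finite P" "\<And>p. p \<in> P \<Longrightarrow> prime p \<and> p \<ge> 3" "card P = m" "44 \<le> m" "m \<le> 72"
  shows "\<exists>h. bij_betw h {..<2 ^ m} (Pow P) \<and> (\<forall>i<2 ^ m. \<forall>p\<in>P. p dvd 1 + c * i \<longrightarrow> p \<in> h i)"
\<comment> \<open>\<open>15015 = 3 * 5 * 7 * 11 * 13\<close>. The value \<open>r0 = 5\<close> is the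
  least that satisfies the tail bound: \<open>64 * (40 / 27) ^ 6 < 720\<close>, but
  \<open>64 * (40 / 27) ^ 5 > 120\<close>.\<close>
proof (rule matching_of_bounds[where y = 13 and k = 5 and K = 15015 and lo = 44 and ?r0.0 = 5])
  have L: "filter (\<lambda>p. 3 \<le> p \<and> p \<le> 13) small_primes = [3, 5, 7, 11, 13]" by (simp add: small_primes_def)
  show "card {p \<in> P. p \<le> 13} \<le> 5" "\<Prod>{p \<in> P. p \<le> 13} \<le> 15015"
    using small_part_bounds[of P 13, OF assms(4)] unfolding L by simp_all
  \<comment> \<open>The 40 primes from 17 to 199 and the \<open>8 * 4\<close> numbers in the blocks
    7 to 10 give the upper limit 72 for \<open>m\<close>.\<close>
  have "(\<Sum>p | p \<in> P \<and> 13 < p. 1 / real p) \<le>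
     (\<Sum>p\<leftarrow>filter (\<lambda>p. 13 < p \<and> p < 30 * 7) small_primes. 1 / real p) + 4 / 15 * (ln (real 11) - ln (real 7))"
    by (rule sum_large_part_le) (use assms in \<open>auto simp: small_primes_def\<close>)
  also have "(\<Sum>p\<leftarrow>filter (\<lambda>p. 13 < p \<and> p < 30 * 7) small_primes. 1 / real p) \<le> 60502 / 100000"
    by (simp add: small_primes_def)
  also have "ln (real 11) - ln (real 7) \<le> 1 / 2"
  proof -
    have "11 / 7 \<le> exp (1 / 2 :: real)"
      using exp_lower_Taylor_quadratic[of "1 / 2 :: real"] by (simp add: power2_eq_square)
    then have "ln (11 / 7) \<le> ln (exp (1 / 2 :: real))" by (subst ln_le_cancel_iff) auto
    then show ?thesis using ln_div[of 11 "7::real"] by simp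
  qed
  finally show "(\<Sum>p | p \<in> P \<and> 13 < p. 1 / real p) \<le> 20 / 27" by simp
  show "5 * (2 ^ r * (44 choose r) * 15015) \<le> 2 * 2 ^ 44" if "r \<le> 5" for r :: nat
    by (rule choose_error_le[OF that]) (simp_all add: fact_numeral)
qed (use assms in \<open>auto simp: fact_numeral power_divide\<close>)

lemma matching_71_145:
  fixes c m :: nat and P :: "nat set"
  assumes "0 < c" "c \<le> 2" "finite P" "\<And>p. p \<in> P \<Longrightarrow> prime p \<and> p \<ge> 3" "card P = m" "71 \<le> m" "m \<le> 145"
  shows "\<exists>h. bij_betw h {..<2 ^ m} (Pow P) \<and> (\<forall>i<2 ^ m. \<forall>p\<in>P. p dvd 1 + c * i \<longrightarrow> p \<in> h i)"
proof (rule matching_of_bounds[where y = 29 and k = 9 and K = 3234846615 and lo = 71 and ?r0.0 = 7])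
  have L: "filter (\<lambda>p. 3 \<le> p \<and> p \<le> 29) small_primes = [3, 5, 7, 11, 13, 17, 19, 23, 29]"
    by (simp add: small_primes_def)
  show "card {p \<in> P. p \<le> 29} \<le> 9" "\<Prod>{p \<in> P. p \<le> 29} \<le> 3234846615"
    using small_part_bounds[of P 29, OF assms(4)] unfolding L by simp_all
  \<comment> \<open>The 25 primes from 31 to 149 and the \<open>8 * 15\<close> numbers in the blocks
    5 to 19 give the limit 145.\<close>
  have "(\<Sum>p | p \<in> P \<and> 29 < p. 1 / real p) \<le>
     (\<Sum>p\<leftarrow>filter (\<lambda>p. 29 < p \<and> p < 30 * 5) small_primes. 1 / real p) + 4 / 15 * (ln (real 20) - ln (real 5))"
    by (rule sum_large_part_le) (use assms in \<open>auto simp: small_primes_def\<close>)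
  also have "(\<Sum>p\<leftarrow>filter (\<lambda>p. 29 < p \<and> p < 30 * 5) small_primes. 1 / real p) \<le> 35308 / 100000"
    by (simp add: small_primes_def)
  also have "ln (real 20) - ln (real 5) = ln (2 ^ 2)" using ln_div[of 20 "5::real"] by simp
  also have "\<dots> = 2 * ln 2" by (subst ln_realpow) auto
  finally show "(\<Sum>p | p \<in> P \<and> 29 < p. 1 / real p) \<le> 20 / 27" using ln2_le_25_over_36 by simp
  show "5 * (2 ^ r * (71 choose r) * 3234846615) \<le> 2 * 2 ^ 71" if "r \<le> 7" for r :: nat
    by (rule choose_error_le[OF that]) (simp_all add: fact_numeral)
qed (use assms in \<open>auto simp: fact_numeral power_divide\<close>)

text \<open>From here on \<open>sum_above_le\<close> replaces the list of large primes:
  \<open>a = 2\<close> gives the cut-off 60 and the limit \<open>120 * a = 240\<close>, and the next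
  range has \<open>a = 3\<close>.\<close>

lemma matching_130_240:
  fixes c m :: nat and P :: "nat set"
  assumes "0 < c" "c \<le> 2" "finite P" "\<And>p. p \<in> P \<Longrightarrow> prime p \<and> p \<ge> 3" "card P = m" "130 \<le> m" "m \<le> 240"
  shows "\<exists>h. bij_betw h {..<2 ^ m} (Pow P) \<and> (\<forall>i<2 ^ m. \<forall>p\<in>P. p dvd 1 + c * i \<longrightarrow> p \<in> h i)"
proof (rule matching_of_bounds[where y = 60 and k = 16 and K = 961380175077106319535 and lo = 130 and ?r0.0 = 10])
  have L: "filter (\<lambda>p. 3 \<le> p \<and> p \<le> 60) small_primes =
      [3, 5, 7, 11, 13, 17, 19, 23, 29, 31, 37, 41, 43, 47, 53, 59]"
    by (simp add: small_primes_def)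
  show "card {p \<in> P. p \<le> 60} \<le> 16" "\<Prod>{p \<in> P. p \<le> 60} \<le> 961380175077106319535"
    using small_part_bounds[of P 60, OF assms(4)] unfolding L by simp_all
  show "(\<Sum>p | p \<in> P \<and> 60 < p. 1 / real p) \<le> 20 / 27"
    using sum_above_le[of P 2] assms by simp
  show "5 * (2 ^ r * (130 choose r) * 961380175077106319535) \<le> 2 * 2 ^ 130" if "r \<le> 10" for r :: nat
    by (rule choose_error_le[OF that]) (simp_all add: fact_numeral)
qed (use assms in \<open>auto simp: fact_numeral power_divide\<close>)

lemma matching_241_360:
  fixes c m :: nat and P :: "nat set"
  assumes "0 < c" "c \<le> 2" "finite P" "\<And>p. p \<in> P \<Longrightarrow> prime p \<and> p \<ge> 3" "card P = m" "241 \<le> m" "m \<le> 360"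
  shows "\<exists>h. bij_betw h {..<2 ^ m} (Pow P) \<and> (\<forall>i<2 ^ m. \<forall>p\<in>P. p dvd 1 + c * i \<longrightarrow> p \<in> h i)"
proof (rule matching_of_bounds[where y = 90 and k = 23 and K = 11884370948172775385325268800679155
      and lo = 241 and ?r0.0 = 12])
  have L: "filter (\<lambda>p. 3 \<le> p \<and> p \<le> 90) small_primes =
      [3, 5, 7, 11, 13, 17, 19, 23, 29, 31, 37, 41, 43, 47, 53, 59, 61, 67, 71, 73, 79, 83, 89]"
    by (simp add: small_primes_def)
  show "card {p \<in> P. p \<le> 90} \<le> 23" "\<Prod>{p \<in> P. p \<le> 90} \<le> 11884370948172775385325268800679155"
    using small_part_bounds[of P 90, OF assms(4)] unfolding L by simp_all
  show "(\<Sum>p | p \<in> P \<and> 90 < p. 1 / real p) \<le> 20 / 27"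
    using sum_above_le[of P 3] assms by simp
  show "5 * (2 ^ r * (241 choose r) * 11884370948172775385325268800679155) \<le> 2 * 2 ^ 241"
    if "r \<le> 12" for r :: nat
    by (rule choose_error_le[OF that]) (simp_all add: fact_numeral)
qed (use assms in \<open>auto simp: fact_numeral power_divide\<close>)

text \<open>The left side is at most \<open>60 ^ r * ((4 * a) ^ r / fact r)\<close>. The quotient is
  a term of the series of \<open>exp (4 * a)\<close>, and \<open>exp 4 < 64\<close>, so the product
  is at most \<open>64 ^ (4 * a - 1) * 64 ^ a = 2 ^ (30 * a - 6)\<close>.\<close>

lemma power_mult_choose_le_power:
  assumes "m \<le> 120 * a" "1 \<le> r" "r \<le> 4 * a - 1"
  shows "2 ^ r * (m choose r) \<le> 2 ^ (30 * a - 6)"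
proof -
  have a: "a \<ge> 1" using assms by simp
  have "(m choose r) * fact r \<le> m ^ r" by (rule binomial_fact_pow)
  then have "real ((m choose r) * fact r) \<le> real (m ^ r)" by (rule of_nat_mono)
  then have "real (m choose r) * fact r \<le> real m ^ r" by simp
  also have "\<dots> \<le> (120 * real a) ^ r" using assms(1) by (intro power_mono) auto
  finally have "2 ^ r * real (m choose r) \<le> 2 ^ r * ((120 * real a) ^ r / fact r)"
    by (simp add: pos_le_divide_eq)
  also have "\<dots> = 60 ^ r * ((real (4 * a)) ^ r / fact r)"
  proof -
    have "2 ^ r * (120 * real a) ^ r = 60 ^ r * (real (4 * a)) ^ r"
      unfolding power_mult_distrib[symmetric] by simp
    then show ?thesis by (simp only: times_divide_eq_right)
  qed
  also have "\<dots> \<le> 64 ^ (4 * a - 1) * 64 ^ a"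
  proof (intro mult_mono)
    have "(60::real) ^ r \<le> 64 ^ r" by (intro power_mono) auto
    also have "\<dots> \<le> 64 ^ (4 * a - 1)" using assms(3) by (intro power_increasing) auto
    finally show "(60::real) ^ r \<le> 64 ^ (4 * a - 1)" .
    have "(\<Sum>k\<in>{r}. (real (4 * a)) ^ k / fact k) \<le> (\<Sum>k. (real (4 * a)) ^ k / fact k)"
      using summable_exp[of "real (4 * a)"]
      by (intro sum_le_suminf) (auto simp: divide_inverse mult.commute)
    also have "\<dots> = exp (real (4 * a))" by (simp add: exp_def scaleR_conv_of_real divide_inverse mult.commute)
    also have "\<dots> = exp 1 ^ (4 * a)" by (simp flip: exp_of_nat_mult)
    also have "\<dots> \<le> (272 / 100) ^ (4 * a)" using e_less_272 by (intro power_mono) auto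
    also have "\<dots> = ((272 / 100) ^ 4) ^ a" by (simp add: power_mult)
    also have "\<dots> \<le> 64 ^ a" by (intro power_mono) (auto simp: power_divide)
    finally show "(real (4 * a)) ^ r / fact r \<le> 64 ^ a" by simp
  qed auto
  also have "\<dots> = 64 ^ (5 * a - 1)" using a by (simp flip: power_add)
  also have "(64::real) ^ (5 * a - 1) = 2 ^ (6 * (5 * a - 1))" by (simp add: power_mult)
  also have "6 * (5 * a - 1) = 30 * a - 6" using a by simp
  finally have "real (2 ^ r * (m choose r)) \<le> real (2 ^ (30 * a - 6))" by simp
  then show ?thesis by (simp only: of_nat_le_iff)
qed

lemma matching_ge_361:
  fixes c m :: nat and P :: "nat set"
  assumes "0 < c" "c \<le> 2" "finite P" "\<And>p. p \<in> P \<Longrightarrow> prime p \<and> p \<ge> 3" "card P = m" "361 \<le> m"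
  shows "\<exists>h. bij_betw h {..<2 ^ m} (Pow P) \<and> (\<forall>i<2 ^ m. \<forall>p\<in>P. p dvd 1 + c * i \<longrightarrow> p \<in> h i)"
proof -
  \<comment> \<open>The least \<open>a\<close> with \<open>m \<le> 120 * a\<close>, so that
    \<open>sum_above_le\<close> applies with cut-off \<open>30 * a\<close>. The primorial bound
    replaces explicit products, and \<open>lo\<close> is \<open>m\<close> itself.\<close>
  define a where "a = (m + 119) div 120"
  have a: "4 \<le> a" "m \<le> 120 * a" "120 * a \<le> m + 119" using assms(6) by (auto simp: a_def)
  have pow4: "(4::nat) ^ j = 2 ^ (2 * j)" for j by (simp add: power_mult)
  show ?thesis
  proof (rule matching_of_bounds[where y = "30 * a" and k = "8 * a + 1" and K = "4 ^ (30 * a)" and lo = m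
        and ?r0.0 = "4 * a - 1"])
    show "card {p \<in> P. p \<le> 30 * a} \<le> 8 * a + 1" using assms(4) a(1) by (intro card_odd_primes_le) auto
    have "\<Prod>{p \<in> P. p \<le> 30 * a} \<le> \<Prod>{p. prime p \<and> p \<le> 30 * a}"
    proof (rule prod_le_prod_subset)
      show "finite {p::nat. prime p \<and> p \<le> 30 * a}" by (rule finite_subset[of _ "{..30 * a}"]) auto
    qed (use assms(4) in \<open>auto dest: prime_gt_0_nat\<close>)
    then show "\<Prod>{p \<in> P. p \<le> 30 * a} \<le> 4 ^ (30 * a)" using primorial_le[of "30 * a"] by linarith
    show "(\<Sum>p | p \<in> P \<and> 30 * a < p. 1 / real p) \<le> 20 / 27"
      using assms a by (intro sum_above_le) auto
    show "5 * (2 ^ r * (m choose r) * 4 ^ (30 * a)) \<le> 2 * 2 ^ m" if "1 \<le> r" "r \<le> 4 * a - 1" for r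
    proof -
      have "5 * (2 ^ r * (m choose r) * 4 ^ (30 * a)) \<le> 2 ^ 3 * (2 ^ (30 * a - 6) * 2 ^ (60 * a))"
        using power_mult_choose_le_power[OF a(2) that] by (intro mult_le_mono) (auto simp: pow4)
      also have "\<dots> = 2 ^ (3 + (30 * a - 6 + 60 * a))" by (simp only: power_add)
      \<comment> \<open>The exponent \<open>90 * a - 3\<close> is at most \<open>m + 1\<close> since
        \<open>m \<ge> 120 * a - 119\<close> and \<open>30 * a \<ge> 115\<close>, which holds from
        \<open>a = 4\<close> on.\<close>
      also have "\<dots> \<le> 2 ^ Suc m" using a by (intro power_increasing) auto
      finally show ?thesis by simp
    qed
    have "120 * m * 4 ^ (30 * a) \<le> 2 ^ 14 * 2 ^ a * 2 ^ (60 * a)"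
    proof (rule mult_le_mono)
      have "120 * m \<le> 2 ^ 14 * a" using a(2) by simp
      also have "\<dots> \<le> 2 ^ 14 * 2 ^ a" by (intro mult_le_mono less_imp_le less_exp) auto
      finally show "120 * m \<le> 2 ^ 14 * 2 ^ a" .
    qed (simp add: pow4)
    also have "\<dots> = 2 ^ (14 + a + 60 * a)" by (simp only: power_add)
    also have "\<dots> \<le> 2 ^ m" using a by (intro power_increasing) auto
    finally show "120 * m * 4 ^ (30 * a) \<le> 2 ^ m" .
    have "16 * 4 ^ (8 * a + 1) * 4 ^ (30 * a) = (2::nat) ^ 4 * 2 ^ (16 * a + 2) * 2 ^ (60 * a)"
      unfolding pow4 by simp
    also have "\<dots> = 2 ^ (4 + (16 * a + 2) + 60 * a)" by (simp only: power_add)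
    also have "\<dots> \<le> 2 ^ m" using a by (intro power_increasing) auto
    finally show "16 * 4 ^ (8 * a + 1) * 4 ^ (30 * a) \<le> (2::nat) ^ m" .
    \<comment> \<open>The tail bound reads
      \<open>4 * (160 / 27) ^ (4 * a) \<le> fact (4 * a)\<close>, because
      \<open>2 ^ (8 * a) = 4 ^ (4 * a)\<close>; it follows from the case
      \<open>4 * a = 16\<close>.\<close>
    have "(160 / 27 :: real) ^ (4 * a) / fact (4 * a) \<le> (160 / 27) ^ 16 / fact 16"
      using a(1) by (intro power_div_fact_antimono) auto
    also have "\<dots> \<le> 1 / 4" by (simp add: fact_numeral power_divide)
    finally have "4 * (160 / 27 :: real) ^ (4 * a) \<le> fact (4 * a)" by (simp add: divide_le_eq)
    moreover have "2 * 2 ^ (8 * a + 1) * (40 / 27 :: real) ^ (4 * a) = 4 * (160 / 27) ^ (4 * a)"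
    proof -
      have "(2::real) ^ (8 * a) = 4 ^ (4 * a)" by (simp add: power_mult)
      then show ?thesis by (simp flip: power_mult_distrib)
    qed
    moreover have "Suc (4 * a - 1) = 4 * a" using a by simp
    ultimately show "2 * 2 ^ (8 * a + 1) * (40 / 27) ^ Suc (4 * a - 1) \<le> (fact (Suc (4 * a - 1)) :: real)"
      by simp
  qed (use assms a in auto)
qed

lemma matching_odd_primes:
  fixes c :: nat and P :: "nat set"
  assumes "0 < c" "c \<le> 2" "finite P" "\<And>p. p \<in> P \<Longrightarrow> prime p \<and> p \<ge> 3" "44 \<le> card P"
  shows "\<exists>h. bij_betw h {..<2 ^ card P} (Pow P) \<and>
    (\<forall>i<2 ^ card P. \<forall>p\<in>P. p dvd 1 + c * i \<longrightarrow> p \<in> h i)"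
proof -
  consider "card P \<le> 72" | "71 \<le> card P" "card P \<le> 145" | "130 \<le> card P" "card P \<le> 240"
    | "241 \<le> card P" "card P \<le> 360" | "361 \<le> card P" by linarith
  then show ?thesis
  proof cases
    case 1 then show ?thesis using matching_44_72[OF assms(1-4) refl assms(5)] by blast
  next
    case 2 then show ?thesis using matching_71_145[OF assms(1-4) refl] by blast
  next
    case 3 then show ?thesis using matching_130_240[OF assms(1-4) refl] by blast
  next
    case 4 then show ?thesis using matching_241_360[OF assms(1-4) refl] by blast
  next
    case 5 then show ?thesis using matching_ge_361[OF assms(1-4) refl] by blast
  qed
qed

section \<open>From sets of primes to divisors\<close>

text \<open>\<open>prime_factors\<close> inverts the product map, as all multiplicities in a divisor
  of a squarefree number are at most 1.\<close>

lemma bij_betw_prod_divisors: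
  assumes "squarefree n" "n > 0"
  shows "bij_betw (\<lambda>D. \<Prod>D) (Pow (prime_factors n)) (divisors n)"
proof (rule bij_betw_imageI)
  let ?P = "prime_factors n"
  have dvd_iff: "p dvd \<Prod>D \<longleftrightarrow> p \<in> D" if "D \<subseteq> ?P" "prime p" for D p
  proof -
    have "finite D" using that(1) finite_subset by blast
    then have "p dvd \<Prod>D \<longleftrightarrow> (\<exists>q\<in>D. p dvd q)" using that(2) by (rule prime_dvd_prod_iff)
    also have "\<dots> \<longleftrightarrow> p \<in> D"
    proof
      assume "\<exists>q\<in>D. p dvd q"
      then obtain q where q: "q \<in> D" "p dvd q" by blast
      then have "prime q" using that(1) by (auto simp: in_prime_factors_iff)
      then show "p \<in> D" using primes_dvd_imp_eq[OF that(2) _ q(2)] q(1) by simp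
    qed (use dvd_refl in blast)
    finally show ?thesis .
  qed
  show "inj_on (\<lambda>D. \<Prod>D) (Pow ?P)"
  proof (rule inj_onI)
    fix C D assume CD: "C \<in> Pow ?P" "D \<in> Pow ?P" "\<Prod>C = \<Prod>D"
    show "C = D"
    proof (rule set_eqI)
      fix p
      show "p \<in> C \<longleftrightarrow> p \<in> D"
      proof (cases "prime p")
        case True
        then show ?thesis using dvd_iff[of C p] dvd_iff[of D p] CD by simp
      next
        case False
        then show ?thesis using CD(1,2) by (auto dest: in_prime_factors_imp_prime)
      qed
    qed
  qed
  show "(\<lambda>D. \<Prod>D) ` Pow ?P = divisors n"
  proof (intro equalityI subsetI)
    fix d assume "d \<in> (\<lambda>D. \<Prod>D) ` Pow ?P"
    then obtain D where D: "D \<subseteq> ?P" "d = \<Prod>D" by auto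
    then have "finite D" using finite_subset by blast
    then show "d \<in> divisors n"
      using D by (auto simp: divisors_def prod_primes_dvd_iff in_prime_factors_iff subset_iff)
  next
    fix d assume "d \<in> divisors n"
    then have d: "d dvd n" by (simp add: divisors_def)
    then have sq: "squarefree d" using assms(1) squarefree_mono by blast
    have "d > 0" using d assms(2) by (simp add: dvd_pos_nat)
    have "d = (\<Prod>p\<in>prime_factors d. p ^ multiplicity p d)"
      using \<open>d > 0\<close> by (rule prime_factorization_nat)
    also have "\<dots> = \<Prod>(prime_factors d)"
    proof (rule prod.cong[OF refl])
      fix p assume p: "p \<in> prime_factors d"
      then have "prime p" "multiplicity p d > 0" by (auto simp: prime_factors_multiplicity)
      moreover have "multiplicity p d \<le> 1"
        using sq \<open>d > 0\<close> \<open>prime p\<close> squarefree_factorial_semiring''[of d] by auto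
      ultimately have "multiplicity p d = 1" by simp
      then show "p ^ multiplicity p d = p" by simp
    qed
    finally have "d = \<Prod>(prime_factors d)" .
    moreover have "prime_factors d \<subseteq> ?P" using d assms(2) by (intro dvd_prime_factors) auto
    ultimately show "d \<in> (\<lambda>D. \<Prod>D) ` Pow ?P" by blast
  qed
qed

text \<open>\<open>x\<close> is sent to the product of the primes outside \<open>H x\<close>; since
  \<open>H x\<close> contains every prime factor of \<open>n\<close> dividing \<open>x\<close>, this
  divisor is prime to \<open>x\<close>.\<close>

lemma matchableI:
  assumes "squarefree n" "n > 0"
    and H: "bij_betw H {1..2 ^ card (prime_factors n)} (Pow (prime_factors n))"
    and dvd: "\<And>x p. x \<in> {1..2 ^ card (prime_factors n)} \<Longrightarrow> p \<in> prime_factors n \<Longrightarrow> p dvd x \<Longrightarrow> p \<in> H x"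
  shows "matchable n"
proof -
  let ?P = "prime_factors n"
  have bij: "bij_betw (\<lambda>D. \<Prod>D) (Pow ?P) (divisors n)" by (rule bij_betw_prod_divisors[OF assms(1,2)])
  have cnt: "divisor_count n = 2 ^ card ?P"
    unfolding divisor_count_def using bij_betw_same_card[OF bij] by (simp add: card_Pow)
  have compl: "bij_betw (\<lambda>D. ?P - D) (Pow ?P) (Pow ?P)"
    by (rule bij_betwI[where g = "\<lambda>D. ?P - D"]) auto
  define \<psi> where "\<psi> = (\<lambda>D. \<Prod>D) \<circ> ((\<lambda>D. ?P - D) \<circ> H)"
  have "bij_betw \<psi> {1..divisor_count n} (divisors n)"
    unfolding \<psi>_def cnt by (intro bij_betw_trans[OF _ bij] bij_betw_trans[OF H compl])
  moreover have "gcd x (\<psi> x) = 1" if x: "x \<in> {1..divisor_count n}" for x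
  proof -
    have "coprime x (\<Prod>(?P - H x))"
    proof (rule prod_coprime_right)
      fix p assume p: "p \<in> ?P - H x"
      then have "\<not> p dvd x" using dvd[of x p] x cnt by auto
      then show "coprime x p"
        using p prime_imp_coprime[of p x] by (auto simp: coprime_commute in_prime_factors_iff)
    qed
    then show ?thesis by (simp add: \<psi>_def)
  qed
  moreover have "finite (divisors n)" using bij_betw_finite[OF bij] by simp
  ultimately show ?thesis unfolding matchable_def coprime_matching_def by blast
qed

theorem theorem3p2:
  fixes n :: nat
  assumes "n > 0" and "squarefree n" and "card (prime_factors n) \<ge> 45"
  shows "matchable n"
proof -
  let ?P = "prime_factors n"
  \<comment> \<open>Leaving out 2 turns at least 45 primes into at least 44 odd ones.\<close>
  define P where "P = ?P - {2}"
  have finP: "finite P" by (simp add: P_def)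
  have P: "prime p \<and> p \<ge> 3" if "p \<in> P" for p
    using that prime_ge_2_nat[of p] by (fastforce simp: P_def in_prime_factors_iff)
  have cardP: "card P = (if 2 \<in> ?P then card ?P - 1 else card ?P)"
    by (simp add: P_def card_Diff_singleton_if)
  have ge44: "44 \<le> card P" using assms(3) cardP by auto
  obtain h where h: "bij_betw h {..<2 ^ card P} (Pow P)"
      "\<And>i p. i < 2 ^ card P \<Longrightarrow> p \<in> P \<Longrightarrow> p dvd 1 + 1 * i \<Longrightarrow> p \<in> h i"
    using matching_odd_primes[of 1 P, OF _ _ finP P ge44] by auto
  show ?thesis
  proof (cases "2 \<in> ?P")
    case False
    then have PP: "P = ?P" by (simp add: P_def)
    show ?thesis
    proof (rule matchableI[OF assms(2,1)])
      have "bij_betw (\<lambda>x. x - 1) {1..2 ^ card P} {..<(2::nat) ^ card P}"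
        by (rule bij_betwI[where g = Suc]) auto
      from bij_betw_trans[OF this h(1)]
      show "bij_betw (h \<circ> (\<lambda>x. x - 1)) {1..2 ^ card ?P} (Pow ?P)" unfolding PP .
      fix x p assume "x \<in> {1..2 ^ card ?P}" "p \<in> ?P" "p dvd x"
      then show "p \<in> (h \<circ> (\<lambda>x. x - 1)) x" using h(2)[of "x - 1" p] PP by auto
    qed
  next
    case True
    obtain g where g: "bij_betw g {..<2 ^ card P} (Pow P)"
        "\<And>i p. i < 2 ^ card P \<Longrightarrow> p \<in> P \<Longrightarrow> p dvd 1 + 2 * i \<Longrightarrow> p \<in> g i"
      using matching_odd_primes[of 2 P, OF _ _ finP P ge44] by auto
    have cP: "card ?P = Suc (card P)" using cardP True assms(3) by simp
    have PP: "?P = insert 2 P" "2 \<notin> P" using True by (auto simp: P_def)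
    \<comment> \<open>Even \<open>x = 2 * (1 + i)\<close> use the progression with
      \<open>c = 1\<close> and receive the prime 2 in addition; odd \<open>x = 1 + 2 * i\<close> use
      the one with \<open>c = 2\<close> and do not receive it.\<close>
    define H where "H x = (if even x then insert 2 (h (x div 2 - 1)) else g (x div 2))" for x
    have bounds: "x div 2 - 1 < 2 ^ card P" "odd x \<Longrightarrow> x div 2 < 2 ^ card P"
      if "x \<in> {1..2 ^ card ?P}" for x :: nat
      using that cP by (auto elim!: oddE)
    have hP: "h i \<subseteq> P" "g i \<subseteq> P" if "i < 2 ^ card P" for i
      using that bij_betwE[OF h(1)] bij_betwE[OF g(1)] by auto
    have H2: "2 \<in> H x \<longleftrightarrow> even x" if "x \<in> {1..2 ^ card ?P}" for x
      using bounds[OF that] hP PP(2) by (auto simp: H_def)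
    have "inj_on H {1..2 ^ card ?P}"
    proof (rule inj_onI)
      fix x y assume xy: "x \<in> {1..2 ^ card ?P}" "y \<in> {1..2 ^ card ?P}" "H x = H y"
      note bx = bounds[OF xy(1)] and byy = bounds[OF xy(2)]
      show "x = y"
      proof (cases "even x")
        case True
        then have ev: "even y" using H2 xy by blast
        have "insert 2 (h (x div 2 - 1)) = insert 2 (h (y div 2 - 1))"
          using xy(3) True ev by (simp add: H_def)
        then have "h (x div 2 - 1) = h (y div 2 - 1)"
          using hP(1)[OF bx(1)] hP(1)[OF byy(1)] PP(2) by (metis insert_ident subsetD)
        then have "x div 2 - 1 = y div 2 - 1"
          using bij_betw_imp_inj_on[OF h(1)] bx(1) byy(1) by (auto dest: inj_onD)
        then show ?thesis using True ev xy(1,2) by (auto elim!: evenE)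
      next
        case False
        then have od: "odd y" using H2 xy by blast
        have "g (x div 2) = g (y div 2)" using xy(3) False od by (simp add: H_def)
        then have "x div 2 = y div 2"
          using bij_betw_imp_inj_on[OF g(1)] bx(2)[OF False] byy(2)[OF od] by (auto dest: inj_onD)
        then show ?thesis using False od by (auto elim!: oddE)
      qed
    qed
    moreover have "H ` {1..2 ^ card ?P} \<subseteq> Pow ?P"
    proof (rule image_subsetI)
      fix x :: nat assume "x \<in> {1..2 ^ card ?P}"
      then show "H x \<in> Pow ?P" using bounds[of x] hP PP(1) by (auto simp: H_def)
    qed
    ultimately have bij: "bij_betw H {1..2 ^ card ?P} (Pow ?P)"
      by (intro bij_betw_imageI card_subset_eq) (auto simp: card_image card_Pow)
    show ?thesis
    proof (rule matchableI[OF assms(2,1) bij])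
      fix x p assume x: "x \<in> {1..2 ^ card ?P}" and p: "p \<in> ?P" "p dvd x"
      show "p \<in> H x"
      proof (cases "p = 2")
        case True
        then show ?thesis using H2[OF x] p by simp
      next
        case False
        then have pP: "p \<in> P" using p by (simp add: P_def)
        show ?thesis
        proof (cases "even x")
          case True
          have "p dvd 2 * (x div 2)" using p(2) True by simp
          moreover have "\<not> p dvd 2" using P[OF pP] by (auto dest: dvd_imp_le)
          ultimately have "p dvd x div 2" using P[OF pP] by (metis prime_dvd_mult_iff)
          moreover have "x div 2 = 1 + 1 * (x div 2 - 1)" using True x by (auto elim!: evenE)
          ultimately have "p \<in> h (x div 2 - 1)" using h(2)[OF bounds(1)[OF x] pP] by simp
          then show ?thesis using True by (simp add: H_def)
        next
          case False
          have "x = 1 + 2 * (x div 2)" using False by simp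
          then have "p \<in> g (x div 2)" using g(2)[OF bounds(2)[OF x False] pP] p(2) by simp
          then show ?thesis using False by (simp add: H_def)
        qed
      qed
    qed
  qed
qed

end
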